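(* Let $\mu\in\mathbb R$, $r>0$ and $x_R>0$ be fixed. Let $\mathcal X(t)$ be drifted Brownian motion (drift $\mu$) with stochastic resetting to $x_R$ at rate $r$, starting from the random initial position $\eta\in(0,+\infty)$, which is supposed to be independent of $\mathcal X(t)$, and let $f(t)$, $t>0$, be a given probability density. Let $\tau=\inf\{t>0:\mathcal X(t)=0\}$. If there exists a solution $g$ to the inverse first-passage time problem for $\mathcal X(t)$, i.e. a probability density $g$ on $(0,+\infty)$ such that, when $\eta$ has density $g$, $P(\tau\le t)=\int_0^t f(s)\,ds$ for all $t>0$, then the following equality holds between the Laplace transform $\widehat f$ of $f$ and the Laplace transform $\widehat g$ of $g$: $$\widehat f(\lambda)=\bigl(1-C(\lambda,\mu,x_R)\bigr)\,\widehat g\Bigl(\mu+\sqrt{\mu^2+2(\lambda+r)}\Bigr)+C(\lambda,\mu,x_R),\qquad \lambda>0,$$ where $$C(\lambda,\mu,x_R)=\frac{r\,e^{-x_R\left(\mu+\sqrt{\mu^2+2(\lambda+r)}\right)}}{\lambda+r\,e^{-x_R\left(\mu+\sqrt{\mu^2+2(\lambda+r)}\right)}}.$$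
   Context: Drifted Brownian motion with resetting: let $X(t)=\eta+\mu t+W_t$, with $W_t$ a standard Brownian motion. Resetting events occur according to a homogeneous Poisson process of rate $r>0$. Until the first resetting event, $\mathcal X(t)$ coincides with $X(t)$, with $\mathcal X(0)=\eta$. At a resetting event $\mathcal X(t)$ is set instantly to $x_R$, after which it evolves again as a Brownian motion with drift $\mu$ starting afresh from $x_R$, independently of the past history, until the next resetting event, and so on. Inter-resetting times are i.i.d. exponential with parameter $r$. "The initial position $\eta$ is independent of $\mathcal X(t)$" means that $\eta$ is independent of the driving randomness (Brownian motion and Poisson resetting process). Laplace transforms: $\widehat f(\lambda)=\int_0^{+\infty}e^{-\lambda t}f(t)\,dt$ for $\lambda>0$, and $\widehat g(\theta)=\int_0^{+\infty}e^{-\theta x}g(x)\,dx$ for $\theta>0$. *)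

theory Defs
  imports "HOL-Probability.Probability"
begin

text \<open>A standard Brownian motion on the probability space \<open>M\<close>; only times \<open>t \<ge> 0\<close> matter.\<close>

definition standard_brownian_motion ::
    "'a measure \<Rightarrow> (real \<Rightarrow> 'a \<Rightarrow> real) \<Rightarrow> bool" where
  "standard_brownian_motion M W \<longleftrightarrow>
     (\<forall>t\<ge>0. W t \<in> borel_measurable M) \<and>
     (AE \<omega> in M. W 0 \<omega> = 0) \<and>
     (\<forall>(n::nat) (t::nat \<Rightarrow> real). 0 \<le> t 0 \<and> mono t \<longrightarrow>
        prob_space.indep_vars M (\<lambda>_. borel)
          (\<lambda>i \<omega>. W (t (Suc i)) \<omega> - W (t i) \<omega>) {..<n}) \<and>
     (\<forall>s t. 0 \<le> s \<and> s < t \<longrightarrow>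
        distributed M lborel (\<lambda>\<omega>. W t \<omega> - W s \<omega>) (normal_density 0 (sqrt (t - s)))) \<and>
     (AE \<omega> in M. continuous_on {0..} (\<lambda>t. W t \<omega>))"

text \<open>
  The sources of randomness: the initial position \<open>\<eta>\<close>, the Brownian motion \<open>W n\<close> that drives
  the process between the \<open>n\<close>-th and the \<open>(n+1)\<close>-st resetting event, and the waiting time
  \<open>T n\<close> between these two events (the \<open>0\<close>-th event being time \<open>0\<close>).
\<close>

datatype source = Start | Path nat | Wait nat

fun source_events ::
    "'a measure \<Rightarrow> ('a \<Rightarrow> real) \<Rightarrow> (nat \<Rightarrow> real \<Rightarrow> 'a \<Rightarrow> real) \<Rightarrow> (nat \<Rightarrow> 'a \<Rightarrow> real) \<Rightarrow>
      source \<Rightarrow> 'a set set" where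
  "source_events M \<eta> W T Start = {\<eta> -` A \<inter> space M | A. A \<in> sets borel}"
| "source_events M \<eta> W T (Path n) =
     sigma_sets (space M) {W n t -` A \<inter> space M | t A. 0 \<le> t \<and> A \<in> sets borel}"
| "source_events M \<eta> W T (Wait n) = {T n -` A \<inter> space M | A. A \<in> sets borel}"

text \<open>
  Starting afresh from the resetting point independently of the past is expressed by using a new
  independent Brownian motion after each resetting event; only the restriction of \<open>W n\<close> to
  \<open>[0, T n)\<close> enters.  By the strong Markov property, using the increments
  \<open>B (S\<^sub>n + s) - B S\<^sub>n\<close> of a single Brownian motion \<open>B\<close> after the \<open>n\<close>-th resetting time
  \<open>S\<^sub>n\<close> gives a process with the same law.
\<close>

locale resetting_noise = prob_space M for M :: "'a measure" +
  fixes r :: real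
    and \<eta> :: "'a \<Rightarrow> real"
    and W :: "nat \<Rightarrow> real \<Rightarrow> 'a \<Rightarrow> real"
    and T :: "nat \<Rightarrow> 'a \<Rightarrow> real"
  assumes initial_measurable: "random_variable borel \<eta>"
    and brownian: "standard_brownian_motion M (W n)"
    and waiting: "distributed M lborel (T n) (exponential_density r)"
    and independent: "indep_sets (source_events M \<eta> W T) UNIV"

definition reset_time :: "(nat \<Rightarrow> 'a \<Rightarrow> real) \<Rightarrow> nat \<Rightarrow> 'a \<Rightarrow> real" where
  "reset_time T n \<omega> = (\<Sum>i<n. T i \<omega>)"

text \<open>The Poisson process of rate \<open>r\<close>, almost surely finite.\<close>

definition num_resets :: "(nat \<Rightarrow> 'a \<Rightarrow> real) \<Rightarrow> real \<Rightarrow> 'a \<Rightarrow> nat" where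
  "num_resets T t \<omega> = card {n. 1 \<le> n \<and> reset_time T n \<omega> \<le> t}"

definition resetting_process ::
    "real \<Rightarrow> real \<Rightarrow> ('a \<Rightarrow> real) \<Rightarrow> (nat \<Rightarrow> real \<Rightarrow> 'a \<Rightarrow> real) \<Rightarrow> (nat \<Rightarrow> 'a \<Rightarrow> real) \<Rightarrow>
      real \<Rightarrow> 'a \<Rightarrow> real" where
  "resetting_process \<mu> x\<^sub>R \<eta> W T t \<omega> =
     (let n = num_resets T t \<omega>; s = t - reset_time T n \<omega>
      in (if n = 0 then \<eta> \<omega> else x\<^sub>R) + \<mu> * s + W n s \<omega>)"

text \<open>The infimum of the empty set is \<open>\<infinity>\<close>.\<close>

definition first_passage_time :: "(real \<Rightarrow> 'a \<Rightarrow> real) \<Rightarrow> 'a \<Rightarrow> ereal" where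
  "first_passage_time X \<omega> = Inf (ereal ` {t. 0 < t \<and> X t \<omega> = 0})"

text \<open>Values of a density at nonpositive arguments are irrelevant.\<close>

definition prob_density_pos :: "(real \<Rightarrow> real) \<Rightarrow> bool" where
  "prob_density_pos f \<longleftrightarrow>
     set_borel_measurable lborel {0<..} f \<and> (\<forall>x>0. 0 \<le> f x) \<and>
     (LINT x:{0<..}|lborel. f x) = 1"

text \<open>
  The law of the first-passage time is determined by the law of \<open>\<eta>\<close>, so it does not matter
  which realization of the noise is considered.  Measurability of the first-passage time is what
  gives \<open>P(\<tau> \<le> t)\<close> a meaning, the regularity of the paths being required only almost surely.
\<close>

definition inverse_first_passage_solution ::
    "'a measure \<Rightarrow> real \<Rightarrow> real \<Rightarrow> ('a \<Rightarrow> real) \<Rightarrow> (nat \<Rightarrow> real \<Rightarrow> 'a \<Rightarrow> real) \<Rightarrow>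
      (nat \<Rightarrow> 'a \<Rightarrow> real) \<Rightarrow> (real \<Rightarrow> real) \<Rightarrow> (real \<Rightarrow> real) \<Rightarrow> bool" where
  "inverse_first_passage_solution M \<mu> x\<^sub>R \<eta> W T f g \<longleftrightarrow>
     prob_density_pos g \<and>
     distributed M lborel \<eta> (\<lambda>x. ennreal (indicator {0<..} x * g x)) \<and>
     (let \<tau> = first_passage_time (resetting_process \<mu> x\<^sub>R \<eta> W T)
      in \<tau> \<in> borel_measurable M \<and>
         (\<forall>t>0. measure M {\<omega> \<in> space M. \<tau> \<omega> \<le> ereal t} = (LINT s:{0<..t}|lborel. f s)))"

definition laplace :: "(real \<Rightarrow> real) \<Rightarrow> real \<Rightarrow> real" where
  "laplace f s = (LINT t:{0<..}|lborel. exp (- s * t) * f t)"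

definition reset_coeff :: "real \<Rightarrow> real \<Rightarrow> real \<Rightarrow> real \<Rightarrow> real" where
  "reset_coeff r l \<mu> x\<^sub>R =
     r * exp (- x\<^sub>R * (\<mu> + sqrt (\<mu>\<^sup>2 + 2 * (l + r)))) /
     (l + r * exp (- x\<^sub>R * (\<mu> + sqrt (\<mu>\<^sup>2 + 2 * (l + r)))))"

end

theory Submission
  imports Defs "HOL-Real_Asymp.Real_Asymp"
begin

text \<open>
  The first-passage time is decomposed into cycles, one for each interval between resetting events.
  Let \<open>\<sigma>\<^sub>n\<close> be the time that the \<open>n\<close>-th path needs to reach zero from its starting point, which is
  \<open>\<eta>\<close> for \<open>n = 0\<close> and \<open>x\<^sub>R\<close> otherwise. If \<open>N\<close> is the first cycle with \<open>\<sigma>\<^sub>N < T\<^sub>N\<close>, then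
  \<open>\<tau> = T\<^sub>0 + \<dots> + T\<^sub>N\<^sub>-\<^sub>1 + \<sigma>\<^sub>N\<close>, so that \<open>e\<^sup>-\<^sup>\<lambda>\<^sup>\<tau>\<close> is a sum over \<open>N\<close> of products of one factor per cycle
  (lemma \<open>discount_first_passage_time\<close>). The cycles are independent, and the expectation of each
  factor depends only on \<open>p = E exp (- (\<lambda> + r) \<sigma>)\<close>: a cycle that ends in a hit contributes \<open>p\<close>, because
  an exponential waiting time exceeds \<open>\<sigma>\<close> with conditional probability \<open>exp (- r \<sigma>)\<close>, and a cycle that
  ends in a reset contributes \<open>r / (\<lambda> + r) * (1 - p)\<close> (lemma \<open>expectation_cycle_discounts\<close>).
  What remains is a geometric series, whose sum is the asserted formula
  (lemma \<open>laplace_first_passage\<close>).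

  The analytic core is \<open>E exp (- a \<sigma>) = exp (- \<theta> y)\<close> for the passage of \<open>y + \<mu> t + W t\<close> to zero, where
  \<open>\<theta> = \<mu> + sqrt (\<mu>\<^sup>2 + 2 a)\<close> is the nonnegative root of \<open>\<theta>\<^sup>2 / 2 - \<theta> \<mu> = a\<close>. It comes from optional
  stopping of the martingale \<open>exp (- \<theta> W t - \<theta>\<^sup>2 t / 2)\<close>, which is carried out on dyadic
  grids: for a Gaussian random walk the stopped exponential has expectation 1 and a second moment
  that is bounded independently of the mesh (lemma \<open>stopped_wald_moments\<close>), and a bound in
  \<open>L\<^sup>2\<close> suffices for passing to the limit of finer grids (lemma \<open>expectation_limit_L2_bounded\<close>).
  Grid times detect when a path is below a level, not when it is at it. The hitting time
  of zero is therefore approached from below, by the passage times strictly below the levels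
  \<open>1 / (m + 1)\<close>; this also makes it measurable with respect to the values of the path at dyadic times.
  The transform is known exactly for each level and depends continuously on it.

  Finally, both \<open>E exp (- \<lambda> \<tau>)\<close> and \<open>laplace f \<lambda>\<close> are integrals of the distribution function of \<open>\<tau>\<close>
  against an exponential density, by Tonelli's theorem (lemma \<open>laplace_eq_expectation_discount\<close>).
\<close>

section \<open>Independence and limits of expectations\<close>

text \<open>
  A random argument \<open>X\<close> that is independent of the remaining randomness may be frozen first and
  integrated out afterwards: the joint law of \<open>X\<close> and the identity into \<open>G\<close> is a product measure.
\<close>

lemma (in prob_space) nn_integral_independent_argument:
  assumes X: "X \<in> measurable M N"
    and G: "space G = space M" "sets G \<subseteq> sets M"
    and indep: "indep_set (sigma_sets (space M) {X -` A \<inter> space M |A. A \<in> sets N}) (sets G)"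
    and F: "(\<lambda>(x, \<omega>). F x \<omega>) \<in> borel_measurable (N \<Otimes>\<^sub>M G)"
  shows "(\<integral>\<^sup>+\<omega>. F (X \<omega>) \<omega> \<partial>M) = (\<integral>\<^sup>+x. (\<integral>\<^sup>+\<omega>. F x \<omega> \<partial>M) \<partial>distr M N X)"
proof -
  have id: "(\<lambda>\<omega>. \<omega>) \<in> measurable M G"
    using G by (auto simp: measurable_def)
  interpret D: prob_space "distr M G (\<lambda>\<omega>. \<omega>)"
    by (rule prob_space_distr[OF id])
  interpret X: prob_space "distr M N X"
    by (rule prob_space_distr[OF X])
  have prod: "distr M N X \<Otimes>\<^sub>M distr M G (\<lambda>\<omega>. \<omega>) = distr M (N \<Otimes>\<^sub>M G) (\<lambda>\<omega>. (X \<omega>, \<omega>))"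
  proof (rule pair_measure_eqI)
    fix A B assume A: "A \<in> sets (distr M N X)" and B: "B \<in> sets (distr M G (\<lambda>\<omega>. \<omega>))"
    then have "prob ((X -` A \<inter> space M) \<inter> B) = prob (X -` A \<inter> space M) * prob B"
      using indep unfolding indep_sets2_eq by (metis (mono_tags, lifting) mem_Collect_eq sets_distr sigma_sets.Basic)
    moreover have "(\<lambda>\<omega>. (X \<omega>, \<omega>)) -` (A \<times> B) \<inter> space M = (X -` A \<inter> space M) \<inter> B"
      and "(\<lambda>\<omega>. \<omega>) -` B \<inter> space M = B"
      using B sets.sets_into_space[of B G] G by auto
    ultimately show "emeasure (distr M N X) A * emeasure (distr M G (\<lambda>\<omega>. \<omega>)) B =
        emeasure (distr M (N \<Otimes>\<^sub>M G) (\<lambda>\<omega>. (X \<omega>, \<omega>))) (A \<times> B)"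
      using A B X id
      by (simp add: emeasure_distr emeasure_eq_measure ennreal_mult'')
  qed (auto intro: D.sigma_finite_measure_axioms X.sigma_finite_measure_axioms)
  have "(\<integral>\<^sup>+\<omega>. F (X \<omega>) \<omega> \<partial>M) = (\<integral>\<^sup>+z. (\<lambda>(x, \<omega>). F x \<omega>) z \<partial>distr M (N \<Otimes>\<^sub>M G) (\<lambda>\<omega>. (X \<omega>, \<omega>)))"
    using X id F by (subst nn_integral_distr) (auto intro: measurable_Pair)
  also have "\<dots> = (\<integral>\<^sup>+x. (\<integral>\<^sup>+\<omega>. F x \<omega> \<partial>distr M G (\<lambda>\<omega>. \<omega>)) \<partial>distr M N X)"
    unfolding prod[symmetric] using F by (subst D.nn_integral_fst[symmetric]) simp_all
  also have "\<dots> = (\<integral>\<^sup>+x. (\<integral>\<^sup>+\<omega>. F x \<omega> \<partial>M) \<partial>distr M N X)"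
  proof (rule nn_integral_cong)
    fix x assume "x \<in> space (distr M N X)"
    then have "F x \<in> borel_measurable G"
      using measurable_compose[OF measurable_Pair1' F] by simp
    then show "(\<integral>\<^sup>+\<omega>. F x \<omega> \<partial>distr M G (\<lambda>\<omega>. \<omega>)) = (\<integral>\<^sup>+\<omega>. F x \<omega> \<partial>M)"
      using id by (simp add: nn_integral_distr)
  qed
  finally show ?thesis .
qed

text \<open>
  Boundedness in \<open>L\<^sup>2\<close> implies uniform integrability. Fatou's lemma gives the upper bound. Cutting off
  at \<open>K\<close> changes the expectations of the \<open>Y n\<close> by at most \<open>B / K\<close>, and the truncated variables
  converge by dominated convergence; this gives the lower bound.
\<close>

lemma (in prob_space) expectation_limit_L2_bounded:
  fixes Y :: "nat \<Rightarrow> 'a \<Rightarrow> real" and Z :: "'a \<Rightarrow> real"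
  assumes Y: "\<And>n. Y n \<in> borel_measurable M" "\<And>n \<omega>. 0 \<le> Y n \<omega>"
    and Z: "Z \<in> borel_measurable M"
    and first: "\<And>n. (\<integral>\<^sup>+\<omega>. Y n \<omega> \<partial>M) = ennreal c"
    and second: "\<And>n. (\<integral>\<^sup>+\<omega>. ennreal ((Y n \<omega>)\<^sup>2) \<partial>M) \<le> ennreal B"
    and lim: "AE \<omega> in M. (\<lambda>n. Y n \<omega>) \<longlonglongrightarrow> Z \<omega>"
    and c: "0 \<le> c"  and B: "0 \<le> B"
  shows "integrable M Z" "expectation Z = c"
proof -
  note [measurable] = Y(1) Z
  have Z0: "AE \<omega> in M. 0 \<le> Z \<omega>"
    using lim by eventually_elim (rule LIMSEQ_le_const, auto intro: Y(2))
  have "(\<integral>\<^sup>+\<omega>. ennreal (Z \<omega>) \<partial>M) = (\<integral>\<^sup>+\<omega>. liminf (\<lambda>n. ennreal (Y n \<omega>)) \<partial>M)"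
    by (rule nn_integral_cong_AE, use lim in eventually_elim)
      (metis lim_imp_Liminf tendsto_ennrealI trivial_limit_sequentially)
  also have "\<dots> \<le> liminf (\<lambda>n. \<integral>\<^sup>+\<omega>. ennreal (Y n \<omega>) \<partial>M)"
    by (rule nn_integral_liminf) simp
  finally have le: "(\<integral>\<^sup>+\<omega>. ennreal (Z \<omega>) \<partial>M) \<le> ennreal c"
    by (simp add: first Liminf_const)
  show int: "integrable M Z"
    using le Z0 by (intro integrableI_nonneg) (auto simp: top_unique le_less_trans)
  have upper: "expectation Z \<le> c"
    using le int Z0 c by (simp add: nn_integral_eq_integral)
  have intY: "integrable M (Y n)" for n
    by (intro integrableI_nonneg) (auto simp: Y(2) first)
  have EY: "expectation (Y n) = c" for n
    using first[of n] intY[of n] c Y(2)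
    by (simp add: nn_integral_eq_integral ennreal_inj)
  have intY2: "integrable M (\<lambda>\<omega>. (Y n \<omega>)\<^sup>2)" for n
    using second[of n] by (intro integrableI_nonneg) (auto simp: le_less_trans)
  have EY2: "expectation (\<lambda>\<omega>. (Y n \<omega>)\<^sup>2) \<le> B" for n
    using second[of n] intY2[of n] B by (simp add: nn_integral_eq_integral)
  have lower: "c - B / K \<le> expectation Z" if K: "0 < K" for K
  proof -
    have trunc: "c - B / K \<le> expectation (\<lambda>\<omega>. min (Y n \<omega>) K)" for n
    proof -
      have pw: "Y n \<omega> - (Y n \<omega>)\<^sup>2 / K \<le> min (Y n \<omega>) K" for \<omega>
      proof -
        have "0 \<le> (Y n \<omega> - K)\<^sup>2 + K * Y n \<omega>"
          using K Y(2)[of n \<omega>] by simp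
        then have "K * Y n \<omega> - (Y n \<omega>)\<^sup>2 \<le> K * K"
          by (simp add: power2_eq_square algebra_simps)
        then have "Y n \<omega> - (Y n \<omega>)\<^sup>2 / K \<le> K"
          using K by (simp add: field_simps)
        then show ?thesis
          using K by simp
      qed
      have "c - B / K \<le> expectation (Y n) - expectation (\<lambda>\<omega>. (Y n \<omega>)\<^sup>2) / K"
        using EY2[of n] K by (simp add: EY divide_right_mono)
      also have "\<dots> = expectation (\<lambda>\<omega>. Y n \<omega> - (Y n \<omega>)\<^sup>2 / K)"
        using intY intY2 by simp
      also have "\<dots> \<le> expectation (\<lambda>\<omega>. min (Y n \<omega>) K)"
        using pw intY intY2 K by (intro integral_mono) auto
      finally show ?thesis .
    qed
    have "(\<lambda>n. expectation (\<lambda>\<omega>. min (Y n \<omega>) K)) \<longlonglongrightarrow> expectation (\<lambda>\<omega>. min (Z \<omega>) K)"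
    proof (rule integral_dominated_convergence[where w="\<lambda>_. K"])
      show "AE \<omega> in M. (\<lambda>n. min (Y n \<omega>) K) \<longlonglongrightarrow> min (Z \<omega>) K"
        using lim by eventually_elim (auto intro: tendsto_min)
      show "AE \<omega> in M. norm (min (Y n \<omega>) K) \<le> K" for n
        using Y(2)[of n] K by auto
    qed auto
    then have "c - B / K \<le> expectation (\<lambda>\<omega>. min (Z \<omega>) K)"
      using trunc by (intro LIMSEQ_le_const) auto
    also have "\<dots> \<le> expectation Z"
      using int K by (intro integral_mono) auto
    finally show ?thesis .
  qed
  have "((\<lambda>K. c - B / K) \<longlongrightarrow> c - 0) at_top"
    by (intro tendsto_intros tendsto_divide_0[OF tendsto_const] filterlim_at_top_imp_at_infinity filterlim_ident)
  then have "c \<le> expectation Z"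
    using lower by (intro tendsto_upperbound[of "\<lambda>K. c - B / K" c at_top])
      (auto intro!: eventually_mono[OF eventually_gt_at_top[of 0]])
  with upper show "expectation Z = c" by simp
qed

lemma (in prob_space) nn_integral_indep_var_mult:
  assumes ind: "indep_var S X S' Y"
    and f: "f \<in> borel_measurable S" and g: "g \<in> borel_measurable S'"
  shows "(\<integral>\<^sup>+\<omega>. f (X \<omega>) * g (Y \<omega>) \<partial>M) = (\<integral>\<^sup>+\<omega>. f (X \<omega>) \<partial>M) * (\<integral>\<^sup>+\<omega>. g (Y \<omega>) \<partial>M :: ennreal)"
proof -
  have "indep_vars (case_bool borel borel) (case_bool (f \<circ> X) (g \<circ> Y)) UNIV"
    using indep_var_compose[OF ind f g] by (simp add: indep_var_def)
  then have "indep_vars (\<lambda>_. borel) (case_bool (f \<circ> X) (g \<circ> Y)) UNIV"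
    by (rule indep_vars_cong[THEN iffD1, rotated -1]) (auto split: bool.split)
  from indep_vars_nn_integral[OF _ this] show ?thesis
    by (simp add: UNIV_bool comp_def mult.commute)
qed

lemma (in prob_space) indep_vars_of_subalgebras:
  assumes indep: "indep_sets (\<lambda>i. sets (G i)) I"
    and G: "\<And>i. i \<in> I \<Longrightarrow> space (G i) = space M"
    and V: "\<And>i. i \<in> I \<Longrightarrow> V i \<in> measurable (G i) N"
  shows "indep_vars (\<lambda>_. N) V I"
  unfolding indep_vars_def2
proof (intro conjI ballI)
  have sub: "{V i -` A \<inter> space M |A. A \<in> sets N} \<subseteq> sets (G i)" if "i \<in> I" for i
    using measurable_sets[OF V[OF that]] G[OF that] by auto
  show "indep_sets (\<lambda>i. {V i -` A \<inter> space M |A. A \<in> sets N}) I"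
    using indep_sets_mono_sets[OF indep sub] .
  fix i assume i: "i \<in> I"
  then have "sets (G i) \<subseteq> events"
    using indep by (auto simp: indep_sets_def)
  then show "V i \<in> measurable M N"
    using V[OF i] G[OF i] by (auto simp: measurable_def)
qed

section \<open>The stopped exponential of a Gaussian random walk\<close>

text \<open>
  Completing the square: the factor \<open>exp (a x)\<close> shifts the mean of the normal density to \<open>a s\<^sup>2\<close>.
\<close>

lemma nn_integral_normal_exp:
  assumes s: "0 < s"
  shows "(\<integral>\<^sup>+x. ennreal (normal_density 0 s x) * ennreal (exp (a * x)) \<partial>lborel) = ennreal (exp (a\<^sup>2 * s\<^sup>2 / 2))"
proof -
  have *: "normal_density 0 s x * exp (a * x) = exp (a\<^sup>2 * s\<^sup>2 / 2) * normal_density (a * s\<^sup>2) s x" for x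
  proof -
    have "- x\<^sup>2 / (2 * s\<^sup>2) + a * x = a\<^sup>2 * s\<^sup>2 / 2 + - (x - a * s\<^sup>2)\<^sup>2 / (2 * s\<^sup>2)"
      using s by (simp add: field_simps power2_eq_square)
    then show ?thesis
      by (simp add: normal_density_def mult_exp_exp)
  qed
  have "(\<integral>\<^sup>+x. ennreal (normal_density 0 s x) * ennreal (exp (a * x)) \<partial>lborel)
      = (\<integral>\<^sup>+x. ennreal (exp (a\<^sup>2 * s\<^sup>2 / 2)) * ennreal (normal_density (a * s\<^sup>2) s x) \<partial>lborel)"
    by (intro nn_integral_cong) (simp add: ennreal_mult'[symmetric] *)
  also have "\<dots> = ennreal (exp (a\<^sup>2 * s\<^sup>2 / 2))"
    using s by (simp add: nn_integral_cmult nn_integral_eq_integral)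
  finally show ?thesis .
qed

definition stop_index :: "(nat \<Rightarrow> bool) \<Rightarrow> nat \<Rightarrow> nat" where
  "stop_index H K = (LEAST j. j = K \<or> H j)"

lemma stop_index_0 [simp]: "stop_index H 0 = 0"
  unfolding stop_index_def by (rule Least_equality) auto

lemma stop_index_le: "stop_index H K \<le> K"
  unfolding stop_index_def by (rule Least_le) simp

lemma stop_index_cases: "stop_index H K = K \<or> H (stop_index H K)"
  unfolding stop_index_def by (rule LeastI[where k=K]) simp

lemma stop_index_before: "j < stop_index H K \<Longrightarrow> \<not> H j"
  unfolding stop_index_def using not_less_Least by blast

text \<open>
  Extending the horizon by one step changes the stopping index only if nothing has been hit so far.
  This drives the induction over the horizon.
\<close>

lemma stop_index_Suc:
  "stop_index H (Suc K) = (if \<exists>j\<le>K. H j then stop_index H K else Suc K)"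
proof (cases "\<exists>j\<le>K. H j")
  case True
  have "stop_index H (Suc K) = stop_index H K"
    unfolding stop_index_def[of H "Suc K"]
  proof (rule Least_equality)
    show "stop_index H K = Suc K \<or> H (stop_index H K)"
      using True stop_index_cases[of H K] stop_index_before[of _ H K]
      by (metis le_neq_implies_less)
  next
    fix j assume "j = Suc K \<or> H j"
    then show "stop_index H K \<le> j"
      using stop_index_le[of H K] stop_index_before[of j H K] by (auto simp: not_less[symmetric])
  qed
  then show ?thesis using True by simp
next
  case False
  then show ?thesis
    using stop_index_cases[of H "Suc K"] stop_index_le[of H "Suc K"]
    by (metis le_SucE)
qed

lemma stop_index_no_hit: "\<not> (\<exists>j\<le>K. H j) \<Longrightarrow> stop_index H K = K"
  using stop_index_cases[of H K] stop_index_le[of H K] by auto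

text \<open>
  Wald's exponential martingale at step \<open>j\<close> of the walk with increments \<open>x\<close>, where \<open>\<delta>\<close> is the variance
  of an increment.
\<close>

definition wald :: "real \<Rightarrow> real \<Rightarrow> (nat \<Rightarrow> real) \<Rightarrow> nat \<Rightarrow> real" where
  "wald \<theta> \<delta> x j = exp (- \<theta> * sum x {..<j} - \<theta>\<^sup>2 * \<delta> * real j / 2)"

text \<open>
  Stopping occurs when the walk falls below a moving boundary, since the drift of the Brownian
  motion is moved from the walk into \<open>b\<close>.
\<close>

definition stopped_wald :: "real \<Rightarrow> real \<Rightarrow> (nat \<Rightarrow> real) \<Rightarrow> nat \<Rightarrow> (nat \<Rightarrow> real) \<Rightarrow> real" where
  "stopped_wald \<theta> \<delta> b K x = wald \<theta> \<delta> x (stop_index (\<lambda>j. sum x {..<j} < b j) K)"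

lemma stopped_wald_0 [simp]: "stopped_wald \<theta> \<delta> b 0 x = 1"
  by (simp add: stopped_wald_def wald_def)

lemma stopped_wald_Suc:
  "stopped_wald \<theta> \<delta> b (Suc K) x =
     stopped_wald \<theta> \<delta> b K x *
     (if \<exists>j\<le>K. sum x {..<j} < b j then 1 else exp (- \<theta> * x K - \<theta>\<^sup>2 * \<delta> / 2))"
  by (auto simp: stopped_wald_def stop_index_Suc stop_index_no_hit wald_def mult_exp_exp
        field_simps)

text \<open>
  The value at the horizon \<open>K\<close> is determined by the first \<open>K\<close> increments, hence independent of the
  next one.
\<close>

lemma stopped_wald_restrict:
  "K \<le> L \<Longrightarrow> stopped_wald \<theta> \<delta> b K (restrict x {..<L}) = stopped_wald \<theta> \<delta> b K x"
  by (induction K) (auto simp: stopped_wald_Suc)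

lemma measurable_stopped_wald:
  "K \<le> L \<Longrightarrow> stopped_wald \<theta> \<delta> b K \<in> borel_measurable (PiM {..<L} (\<lambda>_. borel))"
proof (induction K)
  case (Suc K)
  have [measurable]: "stopped_wald \<theta> \<delta> b K \<in> borel_measurable (PiM {..<L} (\<lambda>_. borel))"
    using Suc by simp
  have [measurable]: "(\<lambda>x. sum x {..<j}) \<in> borel_measurable (PiM {..<L} (\<lambda>_. borel :: real measure))" if "j \<le> K" for j
    using that Suc.prems by (intro borel_measurable_sum measurable_component_singleton) auto
  have [measurable]: "(\<lambda>x. x K) \<in> borel_measurable (PiM {..<L} (\<lambda>_. borel :: real measure))"
    using Suc.prems by (intro measurable_component_singleton) auto
  have [measurable]: "Measurable.pred (PiM {..<L} (\<lambda>_. borel)) (\<lambda>x. \<exists>j\<in>{..K}. sum x {..<j} < b j)"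
    by measurable
  show ?case
    unfolding stopped_wald_Suc[abs_def] Bex_def[symmetric] atMost_iff[symmetric]
    by measurable
qed (simp add: stopped_wald_0[abs_def])

text \<open>
  One step of optional stopping: on the event that the walk has not been stopped, the \<open>p\<close>-th power is
  multiplied by an independent factor of known expectation, which is 1 for \<open>p = 1\<close> (the
  martingale property) and \<open>exp (\<theta>\<^sup>2 \<delta>)\<close> for \<open>p = 2\<close>.
\<close>

lemma (in prob_space) stopped_wald_step:
  fixes \<xi> :: "nat \<Rightarrow> 'a \<Rightarrow> real" and \<theta> \<delta> :: real and b :: "nat \<Rightarrow> real"
  assumes indep: "\<And>n. indep_vars (\<lambda>_. borel) \<xi> {..<n}"
    and normal: "\<And>i. distributed M lborel (\<xi> i) (normal_density 0 (sqrt \<delta>))"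
    and \<delta>: "0 < \<delta>"
  defines "Y \<equiv> \<lambda>K \<omega>. stopped_wald \<theta> \<delta> b K (\<lambda>i. \<xi> i \<omega>)"
    and "H \<equiv> \<lambda>K \<omega>. \<exists>j\<le>K. (\<Sum>i<j. \<xi> i \<omega>) < b j"
  shows "(\<integral>\<^sup>+\<omega>. ennreal (Y (Suc K) \<omega> ^ p) \<partial>M) =
     (\<integral>\<^sup>+\<omega>. ennreal (Y K \<omega> ^ p) * indicator {\<omega>. H K \<omega>} \<omega> \<partial>M) +
     (\<integral>\<^sup>+\<omega>. ennreal (Y K \<omega> ^ p) * indicator {\<omega>. \<not> H K \<omega>} \<omega> \<partial>M) *
       ennreal (exp ((real p ^ 2 - real p) * \<theta>\<^sup>2 * \<delta> / 2))"
    (is "_ = ?A + ?B * _") and "Y K \<in> borel_measurable M"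
proof -
  have \<xi>[measurable]: "\<xi> i \<in> borel_measurable M" for i
    using distributed_measurable[OF normal[of i]] by simp
  have vec[measurable]: "(\<lambda>\<omega>. restrict (\<lambda>i. \<xi> i \<omega>) {..<L}) \<in> measurable M (PiM {..<L} (\<lambda>_. borel))" for L
    by (intro measurable_restrict) simp
  have Y_eq: "Y K \<omega> = stopped_wald \<theta> \<delta> b K (restrict (\<lambda>i. \<xi> i \<omega>) {..<K})" for K \<omega>
    by (simp add: Y_def stopped_wald_restrict)
  show Y[measurable]: "Y K \<in> borel_measurable M" for K
    unfolding Y_eq[abs_def] by (rule measurable_compose[OF vec measurable_stopped_wald]) simp
  have [measurable]: "Measurable.pred M (H K)"
    unfolding H_def Bex_def[symmetric] atMost_iff[symmetric] by measurable
  define \<zeta> where "\<zeta> x = ennreal (exp (- \<theta> * x - \<theta>\<^sup>2 * \<delta> / 2) ^ p)" for x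
  have \<zeta>_meas[measurable]: "\<zeta> \<in> borel_measurable borel"
    unfolding \<zeta>_def by measurable
  have step: "ennreal (Y (Suc K) \<omega> ^ p) = ennreal (Y K \<omega> ^ p) * indicator {\<omega>. H K \<omega>} \<omega> +
      ennreal (Y K \<omega> ^ p) * indicator {\<omega>. \<not> H K \<omega>} \<omega> * \<zeta> (\<xi> K \<omega>)" for \<omega>
    by (auto simp: Y_def H_def stopped_wald_Suc \<zeta>_def ennreal_mult'' power_mult_distrib)
  define F where "F x = ennreal (stopped_wald \<theta> \<delta> b K x ^ p) *
      indicator {x. \<not> (\<exists>j\<in>{..K}. sum x {..<j} < b j)} x" for x
  have F: "F \<in> borel_measurable (PiM {..<K} (\<lambda>_. borel))"
  proof -
    have [measurable]: "(\<lambda>x. sum x {..<j}) \<in> borel_measurable (PiM {..<K} (\<lambda>_. borel :: real measure))" if "j \<le> K" for j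
      using that by (intro borel_measurable_sum measurable_component_singleton) auto
    note measurable_stopped_wald[of K K, measurable]
    show ?thesis unfolding F_def by measurable
  qed
  note [measurable] = measurable_compose[OF vec F]
  have F_eq: "ennreal (Y K \<omega> ^ p) * indicator {\<omega>. \<not> H K \<omega>} \<omega> = F (restrict (\<lambda>i. \<xi> i \<omega>) {..<K})" for \<omega>
    unfolding Y_eq F_def H_def by (auto simp: indicator_def)
  have "indep_var (PiM {..<K} (\<lambda>_. borel)) (\<lambda>\<omega>. restrict (\<lambda>i. \<xi> i \<omega>) {..<K})
      (PiM {K} (\<lambda>_. borel)) (\<lambda>\<omega>. restrict (\<lambda>i. \<xi> i \<omega>) {K})"
    by (rule indep_var_restrict[OF indep[of "Suc K"]]) auto
  from nn_integral_indep_var_mult[OF this F, of "\<lambda>x. \<zeta> (x K)"]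
  have "(\<integral>\<^sup>+\<omega>. F (restrict (\<lambda>i. \<xi> i \<omega>) {..<K}) * \<zeta> (\<xi> K \<omega>) \<partial>M) = ?B * (\<integral>\<^sup>+\<omega>. \<zeta> (\<xi> K \<omega>) \<partial>M)"
    by (simp add: F_eq)
  moreover have "(\<integral>\<^sup>+\<omega>. \<zeta> (\<xi> K \<omega>) \<partial>M) = ennreal (exp ((real p ^ 2 - real p) * \<theta>\<^sup>2 * \<delta> / 2))"
  proof -
    have "(\<integral>\<^sup>+\<omega>. \<zeta> (\<xi> K \<omega>) \<partial>M) = (\<integral>\<^sup>+x. ennreal (normal_density 0 (sqrt \<delta>) x) * \<zeta> x \<partial>lborel)"
      using distributed_nn_integral[OF normal[of K], of \<zeta>] by simp
    also have "\<dots> = (\<integral>\<^sup>+x. ennreal (exp (- real p * \<theta>\<^sup>2 * \<delta> / 2)) *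
        (ennreal (normal_density 0 (sqrt \<delta>) x) * ennreal (exp ((- real p * \<theta>) * x))) \<partial>lborel)"
    proof (rule nn_integral_cong)
      fix x :: real
      have "\<zeta> x = ennreal (exp (- real p * \<theta>\<^sup>2 * \<delta> / 2) * exp ((- real p * \<theta>) * x))"
        unfolding \<zeta>_def exp_of_nat_mult[symmetric] mult_exp_exp by (simp add: algebra_simps)
      then show "ennreal (normal_density 0 (sqrt \<delta>) x) * \<zeta> x = ennreal (exp (- real p * \<theta>\<^sup>2 * \<delta> / 2)) *
        (ennreal (normal_density 0 (sqrt \<delta>) x) * ennreal (exp ((- real p * \<theta>) * x)))"
        by (simp add: ennreal_mult ac_simps)
    qed
    also have "\<dots> = ennreal (exp (- real p * \<theta>\<^sup>2 * \<delta> / 2)) * ennreal (exp ((- real p * \<theta>)\<^sup>2 * (sqrt \<delta>)\<^sup>2 / 2))"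
      using \<delta> by (subst nn_integral_cmult) (simp, simp only: nn_integral_normal_exp real_sqrt_gt_0_iff)
    also have "\<dots> = ennreal (exp ((real p ^ 2 - real p) * \<theta>\<^sup>2 * \<delta> / 2))"
      using \<delta> by (simp add: ennreal_mult'[symmetric] mult_exp_exp power_mult_distrib) (simp add: field_simps)
    finally show ?thesis .
  qed
  ultimately show "(\<integral>\<^sup>+\<omega>. ennreal (Y (Suc K) \<omega> ^ p) \<partial>M) = ?A + ?B *
       ennreal (exp ((real p ^ 2 - real p) * \<theta>\<^sup>2 * \<delta> / 2))"
    unfolding step by (subst nn_integral_add) (auto simp: F_eq)
qed

text \<open>
  The bound on the second moment depends only on the elapsed time \<open>\<delta> K\<close>, so it survives a refinement
  of the grid.
\<close>

lemma (in prob_space) stopped_wald_moments: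
  assumes indep: "\<And>n. indep_vars (\<lambda>_. borel) \<xi> {..<n}"
    and normal: "\<And>i. distributed M lborel (\<xi> i) (normal_density 0 (sqrt \<delta>))"
    and \<delta>: "0 < \<delta>"
  shows "(\<lambda>\<omega>. stopped_wald \<theta> \<delta> b K (\<lambda>i. \<xi> i \<omega>)) \<in> borel_measurable M"
    and "(\<integral>\<^sup>+\<omega>. ennreal (stopped_wald \<theta> \<delta> b K (\<lambda>i. \<xi> i \<omega>)) \<partial>M) = 1"
    and "(\<integral>\<^sup>+\<omega>. ennreal ((stopped_wald \<theta> \<delta> b K (\<lambda>i. \<xi> i \<omega>))\<^sup>2) \<partial>M) \<le> ennreal (exp (\<theta>\<^sup>2 * \<delta> * real K))"
proof -
  define Y where "Y K \<omega> = stopped_wald \<theta> \<delta> b K (\<lambda>i. \<xi> i \<omega>)" for K \<omega>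
  define H where "H K \<omega> \<longleftrightarrow> (\<exists>j\<le>K. (\<Sum>i<j. \<xi> i \<omega>) < b j)" for K \<omega>
  note step = stopped_wald_step[OF indep normal \<delta>, of \<theta> b, folded Y_def H_def]
  show "(\<lambda>\<omega>. stopped_wald \<theta> \<delta> b K (\<lambda>i. \<xi> i \<omega>)) \<in> borel_measurable M"
    using step(2)[of K] by (simp add: Y_def[abs_def])
  note [measurable] = step(2)
  have \<xi>[measurable]: "\<xi> i \<in> borel_measurable M" for i
    using distributed_measurable[OF normal[of i]] by simp
  have [measurable]: "Measurable.pred M (H K)" for K
    unfolding H_def Bex_def[symmetric] atMost_iff[symmetric] by measurable
  have split: "(\<integral>\<^sup>+\<omega>. ennreal (Y K \<omega> ^ p) * indicator {\<omega>. H K \<omega>} \<omega> \<partial>M) +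
     (\<integral>\<^sup>+\<omega>. ennreal (Y K \<omega> ^ p) * indicator {\<omega>. \<not> H K \<omega>} \<omega> \<partial>M) = (\<integral>\<^sup>+\<omega>. ennreal (Y K \<omega> ^ p) \<partial>M)" for K p
    by (subst nn_integral_add[symmetric]) (auto intro!: nn_integral_cong simp: indicator_def)
  have "(\<integral>\<^sup>+\<omega>. ennreal (Y K \<omega>) \<partial>M) = 1"
  proof (induction K)
    case 0 show ?case by (simp add: Y_def emeasure_space_1)
  next
    case (Suc K)
    then show ?case using step(1)[of K 1] split[of K 1] by simp
  qed
  then show "(\<integral>\<^sup>+\<omega>. ennreal (stopped_wald \<theta> \<delta> b K (\<lambda>i. \<xi> i \<omega>)) \<partial>M) = 1"
    by (simp add: Y_def)
  have "(\<integral>\<^sup>+\<omega>. ennreal ((Y K \<omega>)\<^sup>2) \<partial>M) \<le> ennreal (exp (\<theta>\<^sup>2 * \<delta> * real K))"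
  proof (induction K)
    case 0 show ?case by (simp add: Y_def emeasure_space_1)
  next
    case (Suc K)
    let ?m = "ennreal (exp (\<theta>\<^sup>2 * \<delta>))"
    let ?A = "\<integral>\<^sup>+\<omega>. ennreal ((Y K \<omega>)\<^sup>2) * indicator {\<omega>. H K \<omega>} \<omega> \<partial>M"
    let ?B = "\<integral>\<^sup>+\<omega>. ennreal ((Y K \<omega>)\<^sup>2) * indicator {\<omega>. \<not> H K \<omega>} \<omega> \<partial>M"
    have "1 \<le> ?m" using \<delta> by simp
    have "(\<integral>\<^sup>+\<omega>. ennreal ((Y (Suc K) \<omega>)\<^sup>2) \<partial>M) = ?A * 1 + ?B * ?m"
      using step(1)[of K 2] by simp
    also have "\<dots> \<le> ?A * ?m + ?B * ?m"
      using \<open>1 \<le> ?m\<close> by (intro add_right_mono mult_left_mono) auto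
    also have "\<dots> = (\<integral>\<^sup>+\<omega>. ennreal ((Y K \<omega>)\<^sup>2) \<partial>M) * ?m"
      using split[of K 2] by (simp add: distrib_right[symmetric])
    also have "\<dots> \<le> ennreal (exp (\<theta>\<^sup>2 * \<delta> * real K)) * ?m"
      using Suc by (intro mult_right_mono) auto
    also have "\<dots> = ennreal (exp (\<theta>\<^sup>2 * \<delta> * real (Suc K)))"
      by (simp add: ennreal_mult'[symmetric] mult_exp_exp algebra_simps)
    finally show ?case .
  qed
  then show "(\<integral>\<^sup>+\<omega>. ennreal ((stopped_wald \<theta> \<delta> b K (\<lambda>i. \<xi> i \<omega>))\<^sup>2) \<partial>M) \<le> ennreal (exp (\<theta>\<^sup>2 * \<delta> * real K))"
    by (simp add: Y_def)
qed

section \<open>Discounting at an extended time\<close>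

text \<open>
  The factor \<open>e\<^sup>-\<^sup>a\<^sup>t\<close>, continued by 0 at infinity: a time that is never reached contributes nothing to
  a Laplace transform.
\<close>

definition discount :: "real \<Rightarrow> ereal \<Rightarrow> real" where
  "discount a t = (if t = \<infinity> then 0 else exp (- a * real_of_ereal t))"

lemma discount_ereal [simp]: "discount a (ereal x) = exp (- a * x)"
  by (simp add: discount_def)

lemma discount_infinity [simp]: "discount a \<infinity> = 0"
  by (simp add: discount_def)

lemma discount_nonneg [simp]: "0 \<le> discount a t"
  by (simp add: discount_def)

lemma discount_le_1: "0 \<le> t \<Longrightarrow> 0 \<le> a \<Longrightarrow> discount a t \<le> 1"
  by (cases t) auto

lemma borel_measurable_discount [measurable]: "discount a \<in> borel_measurable borel"
  unfolding discount_def by measurable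

lemma discount_antimono: "0 \<le> a \<Longrightarrow> 0 \<le> s \<Longrightarrow> s \<le> t \<Longrightarrow> discount a t \<le> discount a s"
  by (cases s; cases t) (auto intro: mult_left_mono)

lemma tendsto_discount:
  assumes lim: "h \<longlonglongrightarrow> s" and "\<And>m. 0 \<le> h m" and "0 \<le> s" and a: "0 < a"
  shows "(\<lambda>m. discount a (h m)) \<longlonglongrightarrow> discount a s"
proof (cases s)
  case (real x)
  then have "\<forall>\<^sub>F m in sequentially. h m < \<infinity>"
    using order_tendstoD(2)[OF lim, of \<infinity>] by simp
  then have "\<forall>\<^sub>F m in sequentially. exp (- a * real_of_ereal (h m)) = discount a (h m)"
    by eventually_elim (auto simp: discount_def)
  moreover have "(\<lambda>m. exp (- a * real_of_ereal (h m))) \<longlonglongrightarrow> exp (- a * x)"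
    using lim real by (intro tendsto_intros lim_real_of_ereal) simp
  ultimately show ?thesis
    using real by (auto dest: tendsto_cong)
next
  case PInf
  show ?thesis
  proof (rule tendstoI)
    fix e :: real assume e: "0 < e"
    define B where "B = max 0 (- ln e / a) + 1"
    have "- ln e / a < B"
      by (simp add: B_def)
    then have "- a * B < ln e"
      using a by (simp add: field_simps)
    then have "exp (- a * B) < e"
      using e by (metis exp_less_mono exp_ln)
    have "\<forall>\<^sub>F m in sequentially. ereal B < h m"
      using order_tendstoD(1)[OF lim, of "ereal B"] PInf by simp
    then show "\<forall>\<^sub>F m in sequentially. dist (discount a (h m)) (discount a s) < e"
    proof eventually_elim
      case (elim m)
      then have "discount a (h m) \<le> discount a (ereal B)"
        using a by (intro discount_antimono) (auto simp: B_def)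
      with \<open>exp (- a * B) < e\<close> show ?case
        by (simp add: PInf)
    qed
  qed
qed (use assms in auto)

text \<open>
  The discount factor is the probability that an exponential time of rate \<open>l\<close> is at least \<open>t\<close>. In
  this form it can be interchanged with an expectation over \<open>t\<close>.
\<close>

lemma discount_eq_nn_integral:
  assumes l: "0 < l" and t: "0 \<le> t"
  shows "ennreal (discount l t) =
    (\<integral>\<^sup>+s. ennreal (exponential_density l s) * indicator {s. t \<le> ereal s} s \<partial>lborel)"
proof (cases t)
  case (real x)
  with t have x: "0 \<le> x" by simp
  have "(\<integral>\<^sup>+s. ennreal (exponential_density l s) * indicator {s. t \<le> ereal s} s \<partial>lborel) =
      (\<integral>\<^sup>+s. ennreal (l * exp (- l * s)) * indicator {x..} s \<partial>lborel)"
    using x real by (intro nn_integral_cong) (auto simp: exponential_density_def indicator_def mult.commute)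
  also have "\<dots> = 0 - (- exp (- l * x))"
  proof (rule nn_integral_FTC_atLeast)
    show "((\<lambda>s. - exp (- l * s)) \<longlongrightarrow> 0) at_top"
      using l by real_asymp
    show "((\<lambda>s. - exp (- l * s)) has_real_derivative l * exp (- l * s)) (at s)" for s
      by (auto intro!: derivative_eq_intros)
  qed (use l in auto)
  finally show ?thesis
    using real by simp
qed (use t in auto)

section \<open>Passage times of continuous paths\<close>

definition grid_passage :: "nat \<Rightarrow> (real \<Rightarrow> real) \<Rightarrow> ereal" where
  "grid_passage n p = (INF k. if p (real k / 2 ^ n) < 0 then ereal (real k / 2 ^ n) else \<infinity>)"

text \<open>
  An infimum over countably many dyadic times, so that it is measurable for every process with
  measurable values. On continuous paths it is the infimum of all nonnegative times at which the
  path is negative.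
\<close>

definition passage_below :: "(real \<Rightarrow> real) \<Rightarrow> ereal" where
  "passage_below p = (INF n. grid_passage n p)"

text \<open>
  On continuous paths with a positive start this is the first zero. The infimum of the dyadic times
  at which the path is negative would not do, because a path may touch zero without crossing it.
\<close>

definition hit_zero :: "(real \<Rightarrow> real) \<Rightarrow> ereal" where
  "hit_zero p = (SUP m. passage_below (\<lambda>t. p t - 1 / real (Suc m)))"

lemma dyadic_between:
  fixes t e :: real
  assumes "0 \<le> t" "0 < e"
  obtains n k :: nat where "t \<le> real k / 2 ^ n" "real k / 2 ^ n < t + e"
proof -
  obtain n where n: "(1 / 2) ^ n < e"
    using real_arch_pow_inv[OF assms(2), of "1/2"] by auto
  define k where "k = nat \<lceil>t * 2 ^ n\<rceil>"
  have k: "real k = of_int \<lceil>t * 2 ^ n\<rceil>"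
    using assms by (simp add: k_def)
  have "t * 2 ^ n \<le> real k" "real k < t * 2 ^ n + 1"
    unfolding k by linarith+
  then have "t \<le> real k / 2 ^ n" "real k / 2 ^ n < t + (1 / 2) ^ n"
    by (simp_all add: field_simps power_one_over)
  with n show ?thesis by (intro that) auto
qed

lemma grid_passage_le: "p (real k / 2 ^ n) < 0 \<Longrightarrow> grid_passage n p \<le> ereal (real k / 2 ^ n)"
  unfolding grid_passage_def by (rule INF_lower2[of k]) auto

lemma passage_below_le_dyadic:
  "p (real k / 2 ^ n) < 0 \<Longrightarrow> passage_below p \<le> ereal (real k / 2 ^ n)"
  unfolding passage_below_def by (rule INF_lower2[of n]) (auto intro: grid_passage_le)

text \<open>
  A continuous path that is negative at \<open>t\<close> is negative at dyadic times arbitrarily close to \<open>t\<close>.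
\<close>

lemma passage_below_le:
  assumes cont: "continuous_on {0..} p" and t: "0 \<le> t" "p t < 0"
  shows "passage_below p \<le> ereal t"
proof (rule ereal_le_epsilon2)
  fix e :: real assume e: "0 < e"
  obtain d where d: "0 < d" "\<And>s. 0 \<le> s \<Longrightarrow> dist s t < d \<Longrightarrow> dist (p s) (p t) < - p t"
    using cont t unfolding continuous_on_iff by (metis atLeast_iff neg_0_less_iff_less)
  obtain n k where nk: "t \<le> real k / 2 ^ n" "real k / 2 ^ n < t + min d e"
    using dyadic_between[of t "min d e"] t d(1) e by (metis min_less_iff_conj)
  then have near: "real k / 2 ^ n < t + d" "real k / 2 ^ n < t + e"
    using min.cobounded1[of d e] min.cobounded2[of d e] by linarith+
  have "p (real k / 2 ^ n) < 0"
    using d(2)[of "real k / 2 ^ n"] nk near by (auto simp: dist_real_def)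
  then have "passage_below p \<le> ereal (real k / 2 ^ n)"
    by (rule passage_below_le_dyadic)
  also have "\<dots> \<le> ereal t + ereal e"
    using near by simp
  finally show "passage_below p \<le> ereal t + ereal e" .
qed

lemma passage_below_lessD:
  assumes "passage_below p < ereal s"
  obtains q where "0 \<le> q" "q < s" "p q < 0"
proof -
  from assms obtain n k where "(if p (real k / 2 ^ n) < 0 then ereal (real k / 2 ^ n) else \<infinity>) < ereal s"
    unfolding passage_below_def grid_passage_def INF_less_iff by auto
  then show ?thesis
    by (intro that[of "real k / 2 ^ n"]) (auto split: if_splits)
qed

lemma grid_passage_nonneg: "0 \<le> grid_passage n p"
  unfolding grid_passage_def by (rule INF_greatest) auto

lemma passage_below_nonneg: "0 \<le> passage_below p"
  unfolding passage_below_def by (rule INF_greatest) (rule grid_passage_nonneg)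

lemma passage_below_mono:
  assumes "\<And>t. p t \<le> q t"
  shows "passage_below p \<le> passage_below q"
  unfolding passage_below_def grid_passage_def
  by (intro INF_mono') (auto intro: le_less_trans[OF assms])

text \<open>
  By the definition of the infimum the path is nonnegative before \<open>h\<close> and negative at \<open>h\<close> or at times
  shortly after \<open>h\<close>, so continuity leaves only the value zero.
\<close>

lemma passage_below_root:
  assumes cont: "continuous_on {0..} p" and start: "0 < p 0" and h: "passage_below p = ereal h"
  shows "p h = 0"
proof -
  have h0: "0 \<le> h"
    using passage_below_nonneg[of p] h by simp
  obtain d where d: "0 < d"
    "\<And>s. p h \<noteq> 0 \<Longrightarrow> 0 \<le> s \<Longrightarrow> s < h + d \<Longrightarrow> h - d < s \<Longrightarrow> dist (p s) (p h) < \<bar>p h\<bar>"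
  proof (cases "p h = 0")
    case False
    then have "0 < \<bar>p h\<bar>" by simp
    with cont h0 obtain d where "0 < d" "\<forall>s\<in>{0..}. dist s h < d \<longrightarrow> dist (p s) (p h) < \<bar>p h\<bar>"
      unfolding continuous_on_iff by (metis atLeast_iff)
    then show ?thesis
      by (intro that[of d]) (auto simp: dist_real_def)
  qed (auto intro: that[of 1])
  have "\<not> p h < 0"
  proof
    assume neg: "p h < 0"
    then have "0 < h"
      using start h0 by (cases "h = 0") auto
    define t where "t = max (h / 2) (h - d / 2)"
    have t: "0 \<le> t" "t < h" "h - d < t"
      using \<open>0 < h\<close> d(1) neg by (auto simp: t_def)
    have "p t < 0"
      using d(2)[of t] neg t d(1) by (auto simp: dist_real_def)
    from passage_below_le[OF cont t(1) this] show False
      using t h by simp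
  qed
  moreover have "\<not> 0 < p h"
  proof
    assume pos: "0 < p h"
    obtain q where q: "0 \<le> q" "q < h + d" "p q < 0"
      using passage_below_lessD[of p "h + d"] d(1) h pos by auto
    have "h \<le> q"
      using passage_below_le[OF cont q(1,3)] h by simp
    then show False
      using d(2)[of q] d(1) q pos by (auto simp: dist_real_def)
  qed
  ultimately show ?thesis by simp
qed

lemma hit_zero_nonneg: "0 \<le> hit_zero p"
  unfolding hit_zero_def by (rule SUP_upper2[of 0]) (auto intro: passage_below_nonneg)

lemma hit_zero_tendsto: "(\<lambda>m. passage_below (\<lambda>t. p t - 1 / real (Suc m))) \<longlonglongrightarrow> hit_zero p"
  unfolding hit_zero_def
proof (rule LIMSEQ_SUP, rule monoI, rule passage_below_mono)
  fix m n :: nat and t assume "m \<le> n"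
  then have "1 / real (Suc n) \<le> 1 / real (Suc m)"
    by (intro divide_left_mono) auto
  then show "p t - 1 / real (Suc m) \<le> p t - 1 / real (Suc n)" by simp
qed

lemma positive_before_hit_zero:
  assumes cont: "continuous_on {0..} p" and t: "0 \<le> t" "ereal t < hit_zero p"
  shows "0 < p t"
proof -
  obtain m where m: "ereal t < passage_below (\<lambda>t. p t - 1 / real (Suc m))"
    using t unfolding hit_zero_def less_SUP_iff by auto
  have "continuous_on {0..} (\<lambda>t. p t - 1 / real (Suc m))"
    by (intro continuous_intros cont)
  from passage_below_le[OF this t(1)] have "\<not> p t - 1 / real (Suc m) < 0"
    using m by (auto simp: not_less[symmetric] simp del: of_nat_Suc)
  moreover have "0 < 1 / real (Suc m)" by simp
  ultimately show ?thesis by linarith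
qed

text \<open>
  At the passage time below the level \<open>1 / (m + 1)\<close> the path has exactly this value, once the level is
  smaller than \<open>p 0\<close>. These times increase to \<open>hit_zero p\<close>, and continuity carries the values
  over to the limit.
\<close>

lemma hit_zero_root:
  assumes cont: "continuous_on {0..} p" and start: "0 < p 0" and s: "hit_zero p = ereal s"
  shows "p s = 0" "0 < s"
proof -
  define h where "h m = passage_below (\<lambda>t. p t - 1 / real (Suc m))" for m
  have h: "h \<longlonglongrightarrow> ereal s" "h m \<le> ereal s" "0 \<le> h m" for m
    using hit_zero_tendsto[of p] SUP_upper[of m UNIV h] passage_below_nonneg
    by (simp_all only: h_def[abs_def] s[symmetric] hit_zero_def UNIV_I)
  define r where "r m = real_of_ereal (h m)" for m
  have r: "h m = ereal (r m)" "0 \<le> r m" for m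
    using h(2,3)[of m] by (cases "h m"; auto simp: r_def)+
  have "r \<longlonglongrightarrow> s"
    using h(1) unfolding r(1)[THEN ext] by simp
  moreover have "0 \<le> s"
    using hit_zero_nonneg[of p] s by simp
  ultimately have "(\<lambda>m. p (r m)) \<longlonglongrightarrow> p s"
    using r(2) by (intro continuous_on_tendsto_compose[OF cont]) auto
  moreover have "(\<lambda>m. p (r m)) \<longlonglongrightarrow> 0"
  proof (rule Lim_transform_eventually)
    show "(\<lambda>m. 1 / real (Suc m)) \<longlonglongrightarrow> 0"
      by (rule LIMSEQ_Suc[OF lim_1_over_n])
    have "\<forall>\<^sub>F m in sequentially. 1 / real (Suc m) < p 0"
      using order_tendstoD(2)[OF LIMSEQ_Suc[OF lim_1_over_n] start] .
    then show "\<forall>\<^sub>F m in sequentially. 1 / real (Suc m) = p (r m)"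
    proof eventually_elim
      case (elim m)
      have "continuous_on {0..} (\<lambda>t. p t - 1 / real (Suc m))"
        by (intro continuous_intros cont)
      from passage_below_root[OF this _ r(1)[of m, unfolded h_def]] elim show ?case
        by simp
    qed
  qed
  ultimately show "p s = 0"
    by (rule LIMSEQ_unique)
  with start \<open>0 \<le> s\<close> show "0 < s"
    by (cases "s = 0") auto
qed

lemma grid_passage_tendsto: "(\<lambda>n. grid_passage n p) \<longlonglongrightarrow> passage_below p"
  unfolding passage_below_def
proof (rule LIMSEQ_INF, rule decseq_SucI)
  show "grid_passage (Suc n) p \<le> grid_passage n p" for n
    unfolding grid_passage_def[of n]
  proof (rule INF_greatest)
    fix k :: nat
    have "real (2 * k) / 2 ^ Suc n = real k / 2 ^ n" by simp
    then show "grid_passage (Suc n) p \<le> (if p (real k / 2 ^ n) < 0 then ereal (real k / 2 ^ n) else \<infinity>)"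
      using grid_passage_le[of p "2 * k" "Suc n"] by auto
  qed
qed

text \<open>
  The link between the discrete stopping rule and passage times on the grid: the horizon of
  \<open>N * 2\<^sup>n\<close> steps is time \<open>N\<close>.
\<close>

lemma stop_index_grid_passage:
  "ereal (real (stop_index (\<lambda>j. p (real j / 2 ^ n) < 0) (N * 2 ^ n)) / 2 ^ n) =
     min (ereal (real N)) (grid_passage n p)"
    (is "ereal (real ?j / _) = _")
proof (rule antisym)
  have "real ?j \<le> real (N * 2 ^ n)"
    using stop_index_le of_nat_le_iff by blast
  then have "real ?j / 2 ^ n \<le> real N"
    by (simp add: field_simps)
  moreover have "ereal (real ?j / 2 ^ n) \<le> grid_passage n p"
    unfolding grid_passage_def
  proof (rule INF_greatest)
    fix k
    have "real ?j / 2 ^ n \<le> real k / 2 ^ n" if "p (real k / 2 ^ n) < 0"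
      using stop_index_before[of k "\<lambda>j. p (real j / 2 ^ n) < 0" "N * 2 ^ n"] that
      by (intro divide_right_mono) (auto simp: not_less[symmetric])
    then show "ereal (real ?j / 2 ^ n) \<le> (if p (real k / 2 ^ n) < 0 then ereal (real k / 2 ^ n) else \<infinity>)"
      by simp
  qed
  ultimately show "ereal (real ?j / 2 ^ n) \<le> min (ereal (real N)) (grid_passage n p)"
    by simp
next
  show "min (ereal (real N)) (grid_passage n p) \<le> ereal (real ?j / 2 ^ n)"
    using stop_index_cases[of "\<lambda>j. p (real j / 2 ^ n) < 0" "N * 2 ^ n"]
      grid_passage_le[of p ?j n]
    by (auto simp: min_le_iff_disj)
qed

section \<open>The Laplace transform of the passage time of drifted Brownian motion\<close>

text \<open>
  The choice of \<open>\<theta>\<close> for which \<open>exp (- \<theta> (\<mu> t + W t) - a t)\<close> is Wald's martingale.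
\<close>

lemma laplace_exponent_root:
  fixes a \<mu> :: real
  assumes "0 \<le> a"
  shows "(\<mu> + sqrt (\<mu>\<^sup>2 + 2 * a))\<^sup>2 / 2 - (\<mu> + sqrt (\<mu>\<^sup>2 + 2 * a)) * \<mu> = a"
proof -
  have "(sqrt (\<mu>\<^sup>2 + 2 * a))\<^sup>2 = \<mu>\<^sup>2 + 2 * a"
    using assms by simp
  then show ?thesis
    by (simp add: power2_eq_square algebra_simps)
qed

lemma laplace_exponent_nonneg:
  fixes a \<mu> :: real
  assumes "0 \<le> a"
  shows "0 \<le> \<mu> + sqrt (\<mu>\<^sup>2 + 2 * a)"
proof -
  have "\<bar>\<mu>\<bar> \<le> sqrt (\<mu>\<^sup>2 + 2 * a)"
    using assms by (intro real_le_rsqrt) simp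
  then show ?thesis by simp
qed

lemma measurable_passage_below:
  assumes "\<And>q. 0 \<le> q \<Longrightarrow> P q \<in> borel_measurable M"
  shows "(\<lambda>\<omega>. passage_below (\<lambda>t. P t \<omega>)) \<in> borel_measurable M"
proof -
  have [measurable]: "P (real k / 2 ^ n) \<in> borel_measurable M" for k n :: nat
    by (rule assms) simp
  show ?thesis
    unfolding passage_below_def grid_passage_def by measurable
qed

lemma measurable_hit_zero:
  assumes "\<And>q. 0 \<le> q \<Longrightarrow> P q \<in> borel_measurable M"
  shows "(\<lambda>\<omega>. hit_zero (\<lambda>t. P t \<omega>)) \<in> borel_measurable M"
proof -
  have [measurable]: "(\<lambda>\<omega>. passage_below (\<lambda>t. P t \<omega> - 1 / real (Suc m))) \<in> borel_measurable M" for m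
    by (intro measurable_passage_below borel_measurable_diff borel_measurable_const assms)
  show ?thesis
    unfolding hit_zero_def by measurable
qed

text \<open>
  As the grid is refined, the stopping times decrease to the passage time \<open>h\<close> capped at \<open>N\<close>. If \<open>h \<le> N\<close>,
  the path vanishes at \<open>h\<close> and the limit is \<open>discount a h\<close>. Otherwise the path is nonnegative at \<open>N\<close>, and
  the limit and \<open>discount a h\<close> both lie between 0 and \<open>exp (- a N)\<close>. In particular the overshoot
  below the level disappears in the limit.
\<close>

lemma stopped_exponential_limit:
  fixes p :: "real \<Rightarrow> real" and \<theta> a :: real and N :: nat
  assumes cont: "continuous_on {0..} p" and start: "0 < p 0" and \<theta>: "0 \<le> \<theta>" and a: "0 \<le> a"
  defines "T n \<equiv> real (stop_index (\<lambda>j. p (real j / 2 ^ n) < 0) (N * 2 ^ n)) / 2 ^ n"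
  obtains L where "(\<lambda>n. exp (- \<theta> * p (T n) - a * T n)) \<longlonglongrightarrow> L"
    and "\<bar>L - discount a (passage_below p)\<bar> \<le> exp (- a * real N)"
proof -
  define h where "h = passage_below p"
  obtain s where s: "min (ereal (real N)) h = ereal s" "0 \<le> s"
  proof -
    have "0 \<le> min (ereal (real N)) h" "min (ereal (real N)) h \<le> ereal (real N)"
      using passage_below_nonneg[of p] by (simp_all add: h_def)
    then show ?thesis
      by (cases "min (ereal (real N)) h") (auto intro: that)
  qed
  have "(\<lambda>n. ereal (T n)) \<longlonglongrightarrow> ereal s"
    unfolding T_def stop_index_grid_passage s(1)[symmetric] h_def
    by (intro tendsto_min tendsto_const grid_passage_tendsto)
  then have T: "T \<longlonglongrightarrow> s" by simp
  have T0: "0 \<le> T n" for n by (simp add: T_def)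
  have "(\<lambda>n. p (T n)) \<longlonglongrightarrow> p s"
    using s(2) T by (intro continuous_on_tendsto_compose[OF cont]) (auto simp: T0)
  then have lim: "(\<lambda>n. exp (- \<theta> * p (T n) - a * T n)) \<longlonglongrightarrow> exp (- \<theta> * p s - a * s)"
    by (intro tendsto_intros T)
  have "\<bar>exp (- \<theta> * p s - a * s) - discount a h\<bar> \<le> exp (- a * real N)"
  proof (cases "h \<le> ereal (real N)")
    case True
    then have "h = ereal s" using s(1) by (simp add: min_def split: if_splits)
    then have "p s = 0"
      using passage_below_root[OF cont start] by (simp add: h_def)
    then show ?thesis
      by (simp add: \<open>h = ereal s\<close>)
  next
    case False
    then have "s = real N" using s(1) by (simp add: min_def split: if_splits)
    have "\<not> p (real N) < 0"
      using passage_below_le[OF cont, of "real N"] False by (auto simp: h_def)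
    then have "exp (- \<theta> * p s - a * s) \<le> exp (- a * real N)"
      using \<theta> by (simp add: \<open>s = real N\<close>)
    moreover have "discount a h \<le> exp (- a * real N)"
      using discount_antimono[of a "ereal (real N)" h] False a by auto
    ultimately show ?thesis
      using discount_nonneg[of a h] exp_ge_zero[of "- \<theta> * p s - a * s"]
      by (simp only: abs_le_iff) linarith
  qed
  with lim that show ?thesis by (simp add: h_def)
qed

text \<open>
  With \<open>a = \<theta>\<^sup>2 / 2 - \<theta> \<mu>\<close>, the stopped exponential of the path \<open>y + \<mu> t + W t\<close> is \<open>exp (- \<theta> y)\<close>
  times a stopped Wald martingale, so its expectation is \<open>exp (- \<theta> y)\<close> on every grid. Refining the
  grid up to a horizon \<open>N\<close> gives the claim up to an error \<open>exp (- a N)\<close>.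
\<close>

lemma (in prob_space) laplace_passage_below:
  assumes BM: "standard_brownian_motion M W" and y: "0 < y" and \<theta>: "0 \<le> \<theta>" and a: "0 < a"
    and root: "\<theta>\<^sup>2 / 2 - \<theta> * \<mu> = a"
  shows "expectation (\<lambda>\<omega>. discount a (passage_below (\<lambda>t. y + \<mu> * t + W t \<omega>))) = exp (- \<theta> * y)"
proof -
  have W[measurable]: "W t \<in> borel_measurable M" if "0 \<le> t" for t
    using BM that by (simp add: standard_brownian_motion_def)
  have W0: "AE \<omega> in M. W 0 \<omega> = 0"
    and cont: "AE \<omega> in M. continuous_on {0..} (\<lambda>t. W t \<omega>)"
    using BM by (simp_all add: standard_brownian_motion_def)
  define D where "D \<omega> = discount a (passage_below (\<lambda>t. y + \<mu> * t + W t \<omega>))" for \<omega>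
  have D[measurable]: "D \<in> borel_measurable M"
    unfolding D_def
    by (rule measurable_compose[OF measurable_passage_below borel_measurable_discount]) simp
  have intD: "integrable M D"
    using a by (intro integrable_const_bound[where B=1])
      (auto simp: D_def intro!: discount_le_1 passage_below_nonneg)
  have approx: "\<bar>exp (- \<theta> * y) - expectation D\<bar> \<le> exp (- a * real N)" for N :: nat
  proof -
    define \<xi> where "\<xi> n i \<omega> = W (real (Suc i) / 2 ^ n) \<omega> - W (real i / 2 ^ n) \<omega>" for n i :: nat and \<omega>
    \<comment> \<open>the boundary at which the walk, without the drift, makes the path negative\<close>
    define b where "b n j = - y - \<mu> * (real j / 2 ^ n)" for n j :: nat
    define Y where "Y n \<omega> = stopped_wald \<theta> (1 / 2 ^ n) (b n) (N * 2 ^ n) (\<lambda>i. \<xi> n i \<omega>)" for n \<omega>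
    have indep: "indep_vars (\<lambda>_. borel) (\<xi> n) {..<m}" for n m
    proof -
      have "mono (\<lambda>i. real i / 2 ^ n)"
        by (intro monoI divide_right_mono) auto
      then show ?thesis
        using BM unfolding standard_brownian_motion_def \<xi>_def by (auto dest!: spec[of _ m] spec[of _ "\<lambda>i. real i / 2 ^ n"])
    qed
    have normal: "distributed M lborel (\<xi> n i) (normal_density 0 (sqrt (1 / 2 ^ n)))" for n i
    proof -
      have "real (Suc i) / 2 ^ n - real i / 2 ^ n = 1 / 2 ^ n"
        by (simp add: field_simps)
      moreover have "0 \<le> real i / 2 ^ n" "real i / 2 ^ n < real (Suc i) / 2 ^ n"
        by (simp_all add: divide_strict_right_mono)
      ultimately show ?thesis
        using BM unfolding standard_brownian_motion_def \<xi>_def by metis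
    qed
    have \<delta>: "0 < 1 / (2::real) ^ n" for n by simp
    note moments = stopped_wald_moments[OF indep normal \<delta>, of \<theta> n "b n" "N * 2 ^ n" for n]
    have Y[measurable]: "Y n \<in> borel_measurable M" for n
      unfolding Y_def[abs_def] by (rule moments)
    \<comment> \<open>taken as a limit of measurable variables: the value of the path at a random time is not obviously measurable\<close>
    define Z where "Z \<omega> = lim (\<lambda>n. Y n \<omega>)" for \<omega>
    have Z[measurable]: "Z \<in> borel_measurable M"
      unfolding Z_def by measurable
    have key: "AE \<omega> in M. (\<lambda>n. Y n \<omega>) \<longlonglongrightarrow> Z \<omega> \<and> \<bar>exp (- \<theta> * y) * Z \<omega> - D \<omega>\<bar> \<le> exp (- a * real N)"
      using W0 cont
    proof eventually_elim
      case (elim \<omega>)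
      define p where "p t = y + \<mu> * t + W t \<omega>" for t
      define T where "T n = real (stop_index (\<lambda>j. p (real j / 2 ^ n) < 0) (N * 2 ^ n)) / 2 ^ n" for n
      have walk: "(\<Sum>i<j. \<xi> n i \<omega>) = W (real j / 2 ^ n) \<omega>" for n j
        unfolding \<xi>_def using sum_lessThan_telescope[of "\<lambda>i. W (real i / 2 ^ n) \<omega>" j] elim(1) by simp
      have index: "stop_index (\<lambda>j. (\<Sum>i<j. \<xi> n i \<omega>) < b n j) (N * 2 ^ n) =
          stop_index (\<lambda>j. p (real j / 2 ^ n) < 0) (N * 2 ^ n)" for n
        unfolding walk by (rule arg_cong2[where f=stop_index]) (auto simp: fun_eq_iff p_def b_def)
      have "Y n \<omega> = exp (- \<theta> * W (T n) \<omega> - \<theta>\<^sup>2 * T n / 2)" for n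
        unfolding Y_def stopped_wald_def index unfolding wald_def walk T_def by simp
      then have "exp (- \<theta> * y) * Y n \<omega> = exp (- \<theta> * p (T n) - a * T n)" for n
        by (simp add: mult_exp_exp p_def root[symmetric] algebra_simps)
      then have Y_eq: "Y n \<omega> = exp (\<theta> * y) * exp (- \<theta> * p (T n) - a * T n)" for n
        by (metis exp_minus_inverse mult.assoc mult_1 mult_minus_left)
      have "continuous_on {0..} p" "0 < p 0"
        unfolding p_def using elim y by (auto intro!: continuous_intros)
      from stopped_exponential_limit[OF this \<theta>, of a N] a
      obtain L where L: "(\<lambda>n. exp (- \<theta> * p (T n) - a * T n)) \<longlonglongrightarrow> L"
          "\<bar>L - discount a (passage_below p)\<bar> \<le> exp (- a * real N)"
        unfolding T_def by auto
      have conv: "(\<lambda>n. Y n \<omega>) \<longlonglongrightarrow> exp (\<theta> * y) * L"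
        unfolding Y_eq by (intro tendsto_intros L)
      then have "Z \<omega> = exp (\<theta> * y) * L"
        unfolding Z_def by (rule limI)
      with conv L(2) show ?case
        by (simp add: D_def p_def[abs_def] mult.assoc[symmetric] mult_exp_exp)
    qed
    have EZ: "integrable M Z" "expectation Z = 1"
    proof -
      have nonneg: "0 \<le> Y n \<omega>" for n \<omega>
        by (simp add: Y_def stopped_wald_def wald_def)
      have first: "(\<integral>\<^sup>+\<omega>. ennreal (Y n \<omega>) \<partial>M) = ennreal 1" for n
        unfolding Y_def using moments(2)[of n] by simp
      have second: "(\<integral>\<^sup>+\<omega>. ennreal ((Y n \<omega>)\<^sup>2) \<partial>M) \<le> ennreal (exp (\<theta>\<^sup>2 * real N))" for n
        unfolding Y_def using moments(3)[of n] by simp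
      have lim: "AE \<omega> in M. (\<lambda>n. Y n \<omega>) \<longlonglongrightarrow> Z \<omega>"
        using key by eventually_elim simp
      show "integrable M Z" "expectation Z = 1"
        using expectation_limit_L2_bounded[OF Y nonneg Z first second lim] by simp_all
    qed
    have "exp (- \<theta> * y) - expectation D = expectation (\<lambda>\<omega>. exp (- \<theta> * y) * Z \<omega> - D \<omega>)"
      using EZ intD by simp
    also have "\<bar>\<dots>\<bar> \<le> expectation (\<lambda>\<omega>. \<bar>exp (- \<theta> * y) * Z \<omega> - D \<omega>\<bar>)"
      by (rule integral_abs_bound)
    also have "\<dots> \<le> expectation (\<lambda>_. exp (- a * real N))"
      using EZ(1) intD key by (intro integral_mono_AE) auto
    finally show ?thesis by (simp add: prob_space)
  qed
  have "(\<lambda>N. exp (- a * real N)) \<longlonglongrightarrow> 0"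
    using tendsto_discount[of "\<lambda>N. ereal (real N)" \<infinity> a] a
    by (simp add: tendsto_PInfty_eq_at_top filterlim_real_sequentially)
  then have "\<bar>exp (- \<theta> * y) - expectation D\<bar> \<le> 0"
    by (rule LIMSEQ_le_const) (use approx in auto)
  then show ?thesis by (simp add: D_def[abs_def])
qed

text \<open>
  The passage below \<open>1 / (m + 1)\<close> from the start \<open>y\<close> is a passage below zero from \<open>y - 1 / (m + 1)\<close>.
  Its transform tends to \<open>exp (- \<theta> y)\<close>, and the passage times increase to the hitting time.
\<close>

lemma (in prob_space) laplace_hit_zero:
  assumes BM: "standard_brownian_motion M W" and y: "0 < y" and \<theta>: "0 \<le> \<theta>" and a: "0 < a"
    and root: "\<theta>\<^sup>2 / 2 - \<theta> * \<mu> = a"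
  shows "(\<integral>\<^sup>+\<omega>. ennreal (discount a (hit_zero (\<lambda>t. y + \<mu> * t + W t \<omega>))) \<partial>M) = ennreal (exp (- \<theta> * y))"
proof -
  have W[measurable]: "W t \<in> borel_measurable M" if "0 \<le> t" for t
    using BM that by (simp add: standard_brownian_motion_def)
  define D where "D m \<omega> = discount a (passage_below (\<lambda>t. (y + \<mu> * t + W t \<omega>) - 1 / real (Suc m)))" for m \<omega>
  define D' where "D' \<omega> = discount a (hit_zero (\<lambda>t. y + \<mu> * t + W t \<omega>))" for \<omega>
  have D[measurable]: "D m \<in> borel_measurable M" for m
    unfolding D_def
    by (rule measurable_compose[OF measurable_passage_below borel_measurable_discount]) simp
  have D'[measurable]: "D' \<in> borel_measurable M"
    unfolding D'_def
    by (rule measurable_compose[OF measurable_hit_zero borel_measurable_discount]) simp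
  have lim: "(\<lambda>m. D m \<omega>) \<longlonglongrightarrow> D' \<omega>" for \<omega>
    unfolding D_def D'_def
    by (intro tendsto_discount hit_zero_tendsto passage_below_nonneg hit_zero_nonneg a)
  have "(\<lambda>m. expectation (D m)) \<longlonglongrightarrow> expectation D'"
  proof (rule integral_dominated_convergence[where w="\<lambda>_. 1"])
    show "AE \<omega> in M. norm (D m \<omega>) \<le> 1" for m
      using a by (simp add: D_def discount_le_1 passage_below_nonneg)
  qed (use lim in auto)
  moreover have "(\<lambda>m. expectation (D m)) \<longlonglongrightarrow> exp (- \<theta> * (y - 0))"
  proof (rule Lim_transform_eventually)
    show "(\<lambda>m. exp (- \<theta> * (y - 1 / real (Suc m)))) \<longlonglongrightarrow> exp (- \<theta> * (y - 0))"
      by (intro tendsto_intros LIMSEQ_Suc[OF lim_1_over_n])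
    have "\<forall>\<^sub>F m in sequentially. 1 / real (Suc m) < y"
      using order_tendstoD(2)[OF LIMSEQ_Suc[OF lim_1_over_n] y] .
    then show "\<forall>\<^sub>F m in sequentially. exp (- \<theta> * (y - 1 / real (Suc m))) = expectation (D m)"
    proof eventually_elim
      case (elim m)
      have "D m = (\<lambda>\<omega>. discount a (passage_below (\<lambda>t. (y - 1 / real (Suc m)) + \<mu> * t + W t \<omega>)))"
        unfolding D_def by (simp add: algebra_simps)
      then show ?case
        using laplace_passage_below[OF BM _ \<theta> a root, of "y - 1 / real (Suc m)"] elim by simp
    qed
  qed
  ultimately have "expectation D' = exp (- \<theta> * y)"
    using LIMSEQ_unique by fastforce
  moreover have "integrable M D'"
    using a by (intro integrable_const_bound[where B=1])
      (auto simp: D'_def intro!: discount_le_1 hit_zero_nonneg)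
  ultimately have "(\<integral>\<^sup>+\<omega>. ennreal (D' \<omega>) \<partial>M) = ennreal (exp (- \<theta> * y))"
    by (subst nn_integral_eq_integral) (auto simp: D'_def)
  then show ?thesis
    by (simp add: D'_def)
qed

section \<open>Decomposition of the first-passage time into cycles\<close>

text \<open>
  The factor of a cycle with waiting time \<open>t\<close> whose path, left alone, would hit zero at time \<open>s\<close>, in case
  the cycle ends in a reset. The next definition is its factor in case it ends in a hit.
\<close>

definition reset_discount :: "real \<Rightarrow> real \<Rightarrow> ereal \<Rightarrow> real" where
  "reset_discount l t s = (if ereal t \<le> s then exp (- l * t) else 0)"

definition hit_discount :: "real \<Rightarrow> real \<Rightarrow> ereal \<Rightarrow> real" where
  "hit_discount l t s = (if s < ereal t then discount l s else 0)"

lemma borel_measurable_reset_discount: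
  "(\<lambda>(s, t). reset_discount l t s) \<in> borel_measurable (borel \<Otimes>\<^sub>M borel)"
  unfolding reset_discount_def by measurable

lemma borel_measurable_hit_discount:
  "(\<lambda>(s, t). hit_discount l t s) \<in> borel_measurable (borel \<Otimes>\<^sub>M borel)"
  unfolding hit_discount_def by measurable

text \<open>
  With positive waiting times the resetting times increase strictly, so the events counted up to \<open>t\<close>
  are exactly the first \<open>n\<close>.
\<close>

lemma num_resets_eq:
  assumes T: "\<And>i. 0 < T i \<omega>"
    and t: "reset_time T n \<omega> \<le> t" "t < reset_time T (Suc n) \<omega>"
  shows "num_resets T t \<omega> = n"
proof -
  have mono: "strict_mono (\<lambda>n. reset_time T n \<omega>)"
    by (rule strict_monoI_Suc) (simp add: reset_time_def T)
  have "k \<le> n" if "reset_time T k \<omega> \<le> t" for k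
    using strict_mono_less[OF mono, of k "Suc n"] that t by simp
  moreover have "reset_time T k \<omega> \<le> t" if "k \<le> n" for k
    using strict_mono_less_eq[OF mono, of k n] that t by simp
  ultimately have "{k. 1 \<le> k \<and> reset_time T k \<omega> \<le> t} = {1..n}"
    by auto
  then show ?thesis
    by (simp add: num_resets_def)
qed

lemma cycle_exists:
  assumes T: "filterlim (\<lambda>n. reset_time T n \<omega>) at_top sequentially" and t: "0 \<le> t"
  obtains n where "reset_time T n \<omega> \<le> t" "t < reset_time T (Suc n) \<omega>"
proof -
  have "\<exists>n. t < reset_time T n \<omega>"
    using T by (auto simp: filterlim_at_top_dense eventually_sequentially)
  define m where "m = (LEAST n. t < reset_time T n \<omega>)"
  have m: "t < reset_time T m \<omega>"
    unfolding m_def using \<open>\<exists>n. _\<close> by (rule LeastI_ex)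
  then obtain n where n: "m = Suc n"
    using t by (cases m) (auto simp: reset_time_def)
  have "\<not> t < reset_time T n \<omega>"
    using n not_less_Least[of n "\<lambda>n. t < reset_time T n \<omega>"] by (simp add: m_def)
  with m n that[of n] show ?thesis by simp
qed

text \<open>
  At most one summand differs from zero: the one of the first cycle \<open>N\<close> in which the path hits zero before
  the reset. There the product telescopes to \<open>exp (- l (S\<^sub>N + \<sigma>\<^sub>N))\<close>, with \<open>S\<^sub>N\<close> the time of the \<open>N\<close>-th
  reset. A path that reaches zero exactly at the resetting time does not count as a hit, because
  the process is then already at \<open>x\<^sub>R\<close>.
\<close>

lemma discount_first_passage_time:
  fixes T :: "nat \<Rightarrow> 'a \<Rightarrow> real" and W :: "nat \<Rightarrow> real \<Rightarrow> 'a \<Rightarrow> real"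
    and \<eta> :: "'a \<Rightarrow> real" and \<mu> x\<^sub>R l :: real and \<omega> :: 'a
  assumes T: "\<And>i. 0 < T i \<omega>" and lim: "filterlim (\<lambda>n. reset_time T n \<omega>) at_top sequentially"
    and cont: "\<And>n. continuous_on {0..} (\<lambda>t. W n t \<omega>)" and W0: "\<And>n. W n 0 \<omega> = 0"
    and start: "0 < \<eta> \<omega>" "0 < x\<^sub>R"
  defines "\<sigma> \<equiv> \<lambda>n. hit_zero (\<lambda>t. (if n = 0 then \<eta> \<omega> else x\<^sub>R) + \<mu> * t + W n t \<omega>)"
  shows "ennreal (discount l (first_passage_time (resetting_process \<mu> x\<^sub>R \<eta> W T) \<omega>)) =
    (\<Sum>n. (\<Prod>i<n. ennreal (reset_discount l (T i \<omega>) (\<sigma> i))) * ennreal (hit_discount l (T n \<omega>) (\<sigma> n)))"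
    (is "_ = (\<Sum>n. ?F n)")
proof -
  define X where "X = resetting_process \<mu> x\<^sub>R \<eta> W T"
  define S where "S n = reset_time T n \<omega>" for n
  define p where "p n t = (if n = 0 then \<eta> \<omega> else x\<^sub>R) + \<mu> * t + W n t \<omega>" for n t
  have \<sigma>: "\<sigma> n = hit_zero (p n)" for n
    by (simp add: \<sigma>_def p_def[abs_def])
  have p: "continuous_on {0..} (p n)" "0 < p n 0" for n
    using cont[of n] start by (auto simp: p_def[abs_def] W0 intro!: continuous_intros)
  have S_Suc: "S (Suc n) = S n + T n \<omega>" for n
    by (simp add: S_def reset_time_def)
  have mono: "strict_mono S"
    by (rule strict_monoI_Suc) (simp add: S_Suc T)
  have S_nonneg: "0 \<le> S n" for n
    unfolding S_def reset_time_def by (intro sum_nonneg less_imp_le T)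
  have X: "X t \<omega> = p n (t - S n)" if "S n \<le> t" "t < S (Suc n)" for n t
    using num_resets_eq[of T \<omega> n t, OF T] that
    by (simp add: X_def resetting_process_def p_def S_def Let_def)
  show ?thesis
  proof (cases "\<exists>n. \<sigma> n < ereal (T n \<omega>)")
    case True
    define N where "N = (LEAST n. \<sigma> n < ereal (T n \<omega>))"
    have N: "\<sigma> N < ereal (T N \<omega>)"
      unfolding N_def using True by (rule LeastI_ex)
    have before: "ereal (T n \<omega>) \<le> \<sigma> n" if "n < N" for n
      using not_less_Least[OF that[unfolded N_def]] by simp
    obtain s where s: "\<sigma> N = ereal s" "0 \<le> s"
      using N hit_zero_nonneg[of "p N"] by (cases "\<sigma> N") (auto simp: \<sigma>)
    have root: "p N s = 0" "0 < s"
      using hit_zero_root[OF p, of N s] s by (simp_all add: \<sigma>)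
    have "first_passage_time X \<omega> = ereal (S N + s)"
      unfolding first_passage_time_def
    proof (rule antisym)
      have "X (S N + s) \<omega> = 0"
        using X[of N "S N + s"] s N root by (simp add: S_Suc)
      then show "Inf (ereal ` {t. 0 < t \<and> X t \<omega> = 0}) \<le> ereal (S N + s)"
        using root(2) S_nonneg[of N] by (intro Inf_lower) auto
    next
      show "ereal (S N + s) \<le> Inf (ereal ` {t. 0 < t \<and> X t \<omega> = 0})"
      proof (rule Inf_greatest, clarsimp)
        fix t assume t: "0 < t" "X t \<omega> = 0"
        show "S N + s \<le> t"
        proof (rule ccontr)
          assume "\<not> S N + s \<le> t"
          then have less: "t < S N + s" by simp
          obtain n where n: "S n \<le> t" "t < S (Suc n)"
            using cycle_exists[OF lim, of t] t by (auto simp: S_def)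
          have "S n < S (Suc N)"
            using n less s N by (simp add: S_Suc)
          then have "n \<le> N"
            using strict_mono_less[OF mono] by simp
          have "ereal (t - S n) < \<sigma> n"
          proof (cases "n = N")
            case True
            then show ?thesis using less s by simp
          next
            case False
            then have "ereal (T n \<omega>) \<le> \<sigma> n" using before \<open>n \<le> N\<close> by simp
            moreover have "ereal (t - S n) < ereal (T n \<omega>)" using n by (simp add: S_Suc)
            ultimately show ?thesis by (rule less_le_trans[rotated])
          qed
          then have "0 < p n (t - S n)"
            using positive_before_hit_zero[OF p(1), of "t - S n" n] n by (simp add: \<sigma>)
          then show False
            using X[OF n] t by simp
        qed
      qed
    qed
    then have "ennreal (discount l (first_passage_time X \<omega>)) = ennreal (exp (- l * (S N + s)))"
      by simp
    also have "exp (- l * (S N + s)) = (\<Prod>i<N. exp (- l * T i \<omega>)) * exp (- l * s)"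
      by (simp add: S_def reset_time_def exp_sum[symmetric] sum_distrib_left mult_exp_exp distrib_left)
    also have "ennreal \<dots> = (\<Prod>i<N. ennreal (exp (- l * T i \<omega>))) * ennreal (exp (- l * s))"
      by (simp add: ennreal_mult prod_nonneg prod_ennreal)
    also have "\<dots> = ?F N"
      using before N s by (simp add: reset_discount_def hit_discount_def)
    also have "\<dots> = (\<Sum>n. ?F n)"
    proof -
      have "?F n = 0" if "n \<noteq> N" for n
      proof (cases "n < N")
        case True
        then show ?thesis using before[of n] by (simp add: hit_discount_def not_less)
      next
        case False
        then have "N \<in> {..<n}" using that by simp
        moreover have "ennreal (reset_discount l (T N \<omega>) (\<sigma> N)) = 0"
          using N by (simp add: reset_discount_def)
        ultimately have "(\<Prod>i<n. ennreal (reset_discount l (T i \<omega>) (\<sigma> i))) = 0"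
          by (intro prod_zero) auto
        then show ?thesis by simp
      qed
      then show ?thesis
        by (subst suminf_finite[of "{N}"]) auto
    qed
    finally show ?thesis by (simp add: X_def)
  next
    case False
    then have no_hit: "ereal (T n \<omega>) \<le> \<sigma> n" for n
      by (simp add: not_less)
    have "X t \<omega> \<noteq> 0" if pos: "0 < t" for t
    proof -
      obtain n where n: "S n \<le> t" "t < S (Suc n)"
        using cycle_exists[OF lim less_imp_le[OF pos]] by (auto simp: S_def)
      then have "ereal (t - S n) < ereal (T n \<omega>)" by (simp add: S_Suc)
      then have "ereal (t - S n) < \<sigma> n"
        using no_hit by (rule less_le_trans)
      then have "0 < p n (t - S n)"
        using positive_before_hit_zero[OF p(1), of "t - S n" n] n by (simp add: \<sigma>)
      then show ?thesis
        using X[OF n] by simp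
    qed
    then have "{t. 0 < t \<and> X t \<omega> = 0} = {}" by auto
    then have "first_passage_time X \<omega> = \<infinity>"
      unfolding first_passage_time_def by (simp only: image_empty Inf_empty top_ereal_def)
    moreover have "?F n = 0" for n
      using no_hit[of n] by (simp add: hit_discount_def not_less)
    ultimately show ?thesis
      by (simp only: X_def discount_infinity suminf_zero ennreal_0)
  qed
qed

section \<open>Expectations over independent cycles\<close>

context resetting_noise
begin

text \<open>
  The randomness is organised by sets of sources. Disjoint sets of sources generate independent
  sigma-algebras, and each argument below picks the sources that a variable depends on.
\<close>

abbreviation "events_of \<equiv> source_events M \<eta> W T"

definition sources_algebra :: "source set \<Rightarrow> 'a measure" where
  "sources_algebra K = sigma (space M) (\<Union>s\<in>K. events_of s)"

lemma source_events_subset: "events_of s \<subseteq> events"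
  using independent unfolding indep_sets_def by blast

lemma source_events_Pow: "(\<Union>s\<in>K. events_of s) \<subseteq> Pow (space M)"
  by (intro UN_least order_trans[OF source_events_subset sets.space_closed])

lemma space_sources_algebra [simp]: "space (sources_algebra K) = space M"
  unfolding sources_algebra_def by (rule space_measure_of[OF source_events_Pow])

lemma sets_sources_algebra: "sets (sources_algebra K) = sigma_sets (space M) (\<Union>s\<in>K. events_of s)"
  unfolding sources_algebra_def by (rule sets_measure_of[OF source_events_Pow])

lemma sources_algebra_subset: "sets (sources_algebra K) \<subseteq> events"
  unfolding sets_sources_algebra by (intro sets.sigma_sets_subset UN_least source_events_subset)

lemma source_events_in_algebra: "s \<in> K \<Longrightarrow> A \<in> events_of s \<Longrightarrow> A \<in> sets (sources_algebra K)"
  unfolding sets_sources_algebra by (rule sigma_sets.Basic) auto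

text \<open>
  Stability under intersections lets independence pass from the sources to the sigma-algebras that
  they generate jointly.
\<close>

lemma Int_stable_source_events: "Int_stable (events_of s)"
proof -
  have vimages: "Int_stable {X -` A \<inter> space M |A. A \<in> sets borel}" for X :: "'a \<Rightarrow> real"
  proof (rule Int_stableI, clarsimp)
    fix A B :: "real set" assume "A \<in> sets borel" "B \<in> sets borel"
    then show "\<exists>C. X -` A \<inter> space M \<inter> (X -` B \<inter> space M) = X -` C \<inter> space M \<and> C \<in> sets borel"
      by (intro exI[of _ "A \<inter> B"]) auto
  qed
  show ?thesis
  proof (cases s)
    case (Path n)
    let ?S = "sigma (space M) {W n t -` A \<inter> space M | t A. 0 \<le> t \<and> A \<in> sets borel}"
    have "events_of s = sets ?S"
      unfolding Path source_events.simps by (rule sets_measure_of[symmetric]) blast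
    then show ?thesis
      by (intro Int_stableI) (simp only: sets.Int)
  qed (simp_all add: vimages)
qed

lemma indep_sources_algebras:
  assumes "disjoint_family_on K J"
  shows "indep_sets (\<lambda>j. sets (sources_algebra (K j))) J"
  unfolding sets_sources_algebra
  by (rule indep_sets_collect_sigma)
    (use assms independent Int_stable_source_events in \<open>auto intro: indep_sets_mono_index\<close>)

lemma indep_set_sources_algebras:
  assumes "K \<inter> L = {}"
  shows "indep_set (sets (sources_algebra K)) (sets (sources_algebra L))"
proof -
  have "disjoint_family_on (case_bool K L) UNIV"
    using assms by (auto simp: disjoint_family_on_def split: bool.split)
  from indep_sources_algebras[OF this] show ?thesis
    unfolding indep_set_def by (rule indep_sets_mono_sets) (auto split: bool.split)
qed

lemma measurable_sources_algebraI:
  assumes "s \<in> K" and "\<And>A. A \<in> sets N \<Longrightarrow> X -` A \<inter> space M \<in> events_of s" and "X \<in> space M \<rightarrow> space N"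
  shows "X \<in> measurable (sources_algebra K) N"
  using assms by (auto simp: measurable_def intro: source_events_in_algebra)

lemma measurable_eta: "Start \<in> K \<Longrightarrow> \<eta> \<in> borel_measurable (sources_algebra K)"
  by (erule measurable_sources_algebraI) auto

lemma measurable_T: "Wait n \<in> K \<Longrightarrow> T n \<in> borel_measurable (sources_algebra K)"
  by (erule measurable_sources_algebraI) auto

lemma measurable_W: "Path n \<in> K \<Longrightarrow> 0 \<le> t \<Longrightarrow> W n t \<in> borel_measurable (sources_algebra K)"
  by (erule measurable_sources_algebraI) (auto intro: sigma_sets.Basic)

lemma measurable_from_sources: "X \<in> measurable (sources_algebra K) N \<Longrightarrow> X \<in> measurable M N"
  using sources_algebra_subset[of K] by (auto simp: measurable_def)

lemma nn_integral_independent_sources: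
  assumes disj: "K \<inter> L = {}"
    and X: "X \<in> measurable (sources_algebra K) N"
    and F: "(\<lambda>(x, \<omega>). F x \<omega>) \<in> borel_measurable (N \<Otimes>\<^sub>M sources_algebra L)"
  shows "(\<integral>\<^sup>+\<omega>. F (X \<omega>) \<omega> \<partial>M) = (\<integral>\<^sup>+x. (\<integral>\<^sup>+\<omega>. F x \<omega> \<partial>M) \<partial>distr M N X)"
proof (rule nn_integral_independent_argument)
  have "sigma_sets (space M) {X -` A \<inter> space M |A. A \<in> sets N} \<subseteq> sets (sources_algebra K)"
    using measurable_sets[OF X] sets.sigma_sets_subset[of "{X -` A \<inter> space M |A. A \<in> sets N}" "sources_algebra K"]
    by auto
  with indep_set_sources_algebras[OF disj]
  show "indep_set (sigma_sets (space M) {X -` A \<inter> space M |A. A \<in> sets N}) (sets (sources_algebra L))"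
    unfolding indep_sets2_eq by blast
qed (use measurable_from_sources[OF X] F sources_algebra_subset in auto)

definition cycle_hit :: "real \<Rightarrow> real \<Rightarrow> nat \<Rightarrow> 'a \<Rightarrow> ereal" where
  "cycle_hit \<mu> x\<^sub>R n \<omega> = hit_zero (\<lambda>t. (if n = 0 then \<eta> \<omega> else x\<^sub>R) + \<mu> * t + W n t \<omega>)"

definition path_sources :: "nat \<Rightarrow> source set" where
  "path_sources n = (if n = 0 then {Start, Path 0} else {Path n})"

lemma measurable_cycle_hit:
  assumes "path_sources n \<subseteq> K"
  shows "cycle_hit \<mu> x\<^sub>R n \<in> borel_measurable (sources_algebra K)"
  unfolding cycle_hit_def
proof (rule measurable_hit_zero)
  fix q :: real assume "0 \<le> q"
  then have [measurable]: "W n q \<in> borel_measurable (sources_algebra K)"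
    using assms by (intro measurable_W) (auto simp: path_sources_def split: if_splits)
  have [measurable]: "(\<lambda>\<omega>. if n = 0 then \<eta> \<omega> else x\<^sub>R) \<in> borel_measurable (sources_algebra K)"
    using assms by (cases "n = 0") (auto simp: path_sources_def intro: measurable_eta)
  show "(\<lambda>\<omega>. (if n = 0 then \<eta> \<omega> else x\<^sub>R) + \<mu> * q + W n q \<omega>) \<in> borel_measurable (sources_algebra K)"
    by measurable
qed

lemma cycle_hit_nonneg: "0 \<le> cycle_hit \<mu> x\<^sub>R n \<omega>"
  unfolding cycle_hit_def by (rule hit_zero_nonneg)

text \<open>
  The path hits zero at \<open>s\<close> before the reset with probability \<open>exp (- r s)\<close>, which turns the rate \<open>l\<close> of
  discounting into \<open>l + r\<close>.
\<close>

lemma nn_integral_hit_discount_waiting: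
  assumes r: "0 < r" and s: "0 \<le> s"
  shows "(\<integral>\<^sup>+\<omega>. ennreal (hit_discount l (T n \<omega>) s) \<partial>M) = ennreal (discount (l + r) s)"
proof (cases s)
  case (real x)
  have [measurable]: "T n \<in> borel_measurable M"
    using distributed_measurable[OF waiting] by simp
  have "(\<integral>\<^sup>+\<omega>. ennreal (hit_discount l (T n \<omega>) s) \<partial>M) =
      (\<integral>\<^sup>+\<omega>. ennreal (exp (- l * x)) * indicator {\<omega>\<in>space M. x < T n \<omega>} \<omega> \<partial>M)"
    by (intro nn_integral_cong) (auto simp: hit_discount_def real indicator_def)
  also have "\<dots> = ennreal (exp (- l * x)) * ennreal (exp (- x * r))"
    using exponential_distributedD_gt[OF waiting _ r, of x n] s real
    by (simp add: nn_integral_cmult_indicator emeasure_eq_measure)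
  also have "\<dots> = ennreal (discount (l + r) s)"
    by (simp add: real ennreal_mult''[symmetric] mult_exp_exp algebra_simps)
  finally show ?thesis .
qed (use s in \<open>auto simp: hit_discount_def\<close>)

text \<open>
  Discounting at rate \<open>l\<close> turns the exponential density of rate \<open>r\<close> into \<open>r / (l + r)\<close> times the one of
  rate \<open>l + r\<close>, and the integral over \<open>t \<le> s\<close> is a value of its distribution function.
\<close>

lemma nn_integral_reset_discount_waiting:
  assumes r: "0 < r" and l: "0 < l" and s: "0 \<le> s"
  shows "(\<integral>\<^sup>+\<omega>. ennreal (reset_discount l (T n \<omega>) s) \<partial>M) = ennreal (r / (l + r) * (1 - discount (l + r) s))"
proof -
  have meas: "(\<lambda>t. ennreal (reset_discount l t s)) \<in> borel_measurable lborel"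
    unfolding reset_discount_def by measurable
  have "(\<integral>\<^sup>+\<omega>. ennreal (reset_discount l (T n \<omega>) s) \<partial>M) =
      (\<integral>\<^sup>+t. ennreal (exponential_density r t) * ennreal (reset_discount l t s) \<partial>lborel)"
    using distributed_nn_integral[OF waiting meas] by simp
  also have "\<dots> = (\<integral>\<^sup>+t. ennreal (r / (l + r)) * (ennreal (exponential_density (l + r) t) * indicator {t. ereal t \<le> s} t) \<partial>lborel)"
  proof (rule nn_integral_cong)
    fix t
    have "exponential_density r t * exp (- l * t) = r / (l + r) * exponential_density (l + r) t"
    proof -
      have "exp (- t * r) * exp (- l * t) = exp (- t * (l + r))"
        by (simp add: mult_exp_exp algebra_simps)
      moreover have "r / (l + r) * (l + r) = r"
        using r l by simp
      ultimately show ?thesis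
        by (simp add: exponential_density_def mult.assoc) (metis mult.assoc mult.commute)
    qed
    then show "ennreal (exponential_density r t) * ennreal (reset_discount l t s) =
        ennreal (r / (l + r)) * (ennreal (exponential_density (l + r) t) * indicator {t. ereal t \<le> s} t)"
      using r l by (simp add: reset_discount_def indicator_def ennreal_mult''[symmetric] ennreal_mult'[symmetric] exponential_density_nonneg)
  qed
  also have "\<dots> = ennreal (r / (l + r)) * (\<integral>\<^sup>+t. ennreal (exponential_density (l + r) t) * indicator {t. ereal t \<le> s} t \<partial>lborel)"
    by (intro nn_integral_cmult) measurable
  also have "(\<integral>\<^sup>+t. ennreal (exponential_density (l + r) t) * indicator {t. ereal t \<le> s} t \<partial>lborel) = ennreal (1 - discount (l + r) s)"
  proof (cases s)
    case (real x)
    then have "{t. ereal t \<le> s} = {..x}" by auto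
    then show ?thesis
      using nn_integral_erlang_density[of "l + r" 0 x] r l s real by (simp add: erlang_CDF_0)
  next
    case PInf
    interpret E: prob_space "density lborel (exponential_density (l + r))"
      using r l by (intro prob_space_exponential_density) simp
    show ?thesis
      using E.emeasure_space_1 PInf by (simp add: emeasure_density)
  qed (use s in auto)
  finally show ?thesis
    using r l by (subst ennreal_mult') simp_all
qed

text \<open>
  The hitting time of a cycle is frozen and the independent waiting time is integrated out, after which
  both expectations depend on the hitting time only through its transform at \<open>l + r\<close>.
\<close>

lemma expectation_cycle_discounts:
  assumes r: "0 < r" and l: "0 < l" and p: "0 \<le> p"
    and laplace: "(\<integral>\<^sup>+\<omega>. ennreal (discount (l + r) (cycle_hit \<mu> x\<^sub>R n \<omega>)) \<partial>M) = ennreal p"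
  shows "(\<integral>\<^sup>+\<omega>. ennreal (hit_discount l (T n \<omega>) (cycle_hit \<mu> x\<^sub>R n \<omega>)) \<partial>M) = ennreal p"
    and "(\<integral>\<^sup>+\<omega>. ennreal (reset_discount l (T n \<omega>) (cycle_hit \<mu> x\<^sub>R n \<omega>)) \<partial>M) = ennreal (r / (l + r) * (1 - p))"
proof -
  let ?\<sigma> = "cycle_hit \<mu> x\<^sub>R n"
  have disj: "path_sources n \<inter> {Wait n} = {}"
    by (auto simp: path_sources_def)
  have \<sigma>: "?\<sigma> \<in> borel_measurable (sources_algebra (path_sources n))"
    by (rule measurable_cycle_hit) simp
  note \<sigma>M[measurable] = measurable_from_sources[OF \<sigma>]
  have T[measurable]: "T n \<in> borel_measurable (sources_algebra {Wait n})"
    by (rule measurable_T) simp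
  have "AE s in distr M borel ?\<sigma>. 0 \<le> s"
    by (subst AE_distr_iff) (auto simp: cycle_hit_nonneg)
  note freeze = nn_integral_independent_sources[OF disj \<sigma>, unfolded split_beta']
  have pair: "(\<lambda>z. (fst z, T n (snd z))) \<in> measurable (borel \<Otimes>\<^sub>M sources_algebra {Wait n}) (borel \<Otimes>\<^sub>M borel)"
    by measurable
  have "(\<integral>\<^sup>+\<omega>. ennreal (hit_discount l (T n \<omega>) (?\<sigma> \<omega>)) \<partial>M) =
      (\<integral>\<^sup>+s. (\<integral>\<^sup>+\<omega>. ennreal (hit_discount l (T n \<omega>) s) \<partial>M) \<partial>distr M borel ?\<sigma>)"
    using measurable_compose[OF pair borel_measurable_hit_discount[of l]]
    by (intro freeze) (simp add: split_beta')
  also have "\<dots> = (\<integral>\<^sup>+s. ennreal (discount (l + r) s) \<partial>distr M borel ?\<sigma>)"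
    using \<open>AE s in _. 0 \<le> s\<close>
    by (intro nn_integral_cong_AE) (auto simp: nn_integral_hit_discount_waiting[OF r])
  also have "\<dots> = ennreal p"
    by (subst nn_integral_distr) (simp_all add: laplace)
  finally show "(\<integral>\<^sup>+\<omega>. ennreal (hit_discount l (T n \<omega>) (?\<sigma> \<omega>)) \<partial>M) = ennreal p" .
  have int: "integrable M (\<lambda>\<omega>. discount (l + r) (?\<sigma> \<omega>))"
    using r l by (intro integrable_const_bound[where B=1]) (auto intro!: discount_le_1 cycle_hit_nonneg)
  have nonneg: "0 \<le> r / (l + r) * (1 - discount (l + r) (?\<sigma> \<omega>))" for \<omega>
    using discount_le_1[OF cycle_hit_nonneg[of \<mu> x\<^sub>R n \<omega>], of "l + r"] r l by (intro mult_nonneg_nonneg) auto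
  have Ep: "expectation (\<lambda>\<omega>. discount (l + r) (?\<sigma> \<omega>)) = p"
    using laplace p by (simp add: nn_integral_eq_integral[OF int])
  have "(\<integral>\<^sup>+\<omega>. ennreal (reset_discount l (T n \<omega>) (?\<sigma> \<omega>)) \<partial>M) =
      (\<integral>\<^sup>+s. (\<integral>\<^sup>+\<omega>. ennreal (reset_discount l (T n \<omega>) s) \<partial>M) \<partial>distr M borel ?\<sigma>)"
    using measurable_compose[OF pair borel_measurable_reset_discount[of l]]
    by (intro freeze) (simp add: split_beta')
  also have "\<dots> = (\<integral>\<^sup>+s. ennreal (r / (l + r) * (1 - discount (l + r) s)) \<partial>distr M borel ?\<sigma>)"
    using \<open>AE s in _. 0 \<le> s\<close>
    by (intro nn_integral_cong_AE) (auto simp: nn_integral_reset_discount_waiting[OF r l])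
  also have "\<dots> = (\<integral>\<^sup>+\<omega>. ennreal (r / (l + r) * (1 - discount (l + r) (?\<sigma> \<omega>))) \<partial>M)"
    by (subst nn_integral_distr) simp_all
  also have "\<dots> = ennreal (expectation (\<lambda>\<omega>. r / (l + r) * (1 - discount (l + r) (?\<sigma> \<omega>))))"
    using int by (intro nn_integral_eq_integral AE_I2 nonneg) simp
  also have "\<dots> = ennreal (r / (l + r) * (1 - p))"
    using int by (simp add: Ep prob_space)
  finally show "(\<integral>\<^sup>+\<omega>. ennreal (reset_discount l (T n \<omega>) (?\<sigma> \<omega>)) \<partial>M) = ennreal (r / (l + r) * (1 - p))" .
qed

text \<open>
  In the first cycle the random start \<open>\<eta>\<close> is independent of the path, so it is frozen and integrated
  out last.
\<close>

lemma laplace_cycle_hit: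
  assumes start: "AE \<omega> in M. 0 < \<eta> \<omega>" "0 < x\<^sub>R" and \<theta>: "0 \<le> \<theta>" and a: "0 < a"
    and root: "\<theta>\<^sup>2 / 2 - \<theta> * \<mu> = a"
  shows "(\<integral>\<^sup>+\<omega>. ennreal (discount a (cycle_hit \<mu> x\<^sub>R n \<omega>)) \<partial>M) =
    (if n = 0 then \<integral>\<^sup>+\<omega>. ennreal (exp (- \<theta> * \<eta> \<omega>)) \<partial>M else ennreal (exp (- \<theta> * x\<^sub>R)))"
proof (cases "n = 0")
  case False
  then show ?thesis
    using laplace_hit_zero[OF brownian[of n] start(2) \<theta> a root] by (simp add: cycle_hit_def)
next
  case True
  have \<eta>: "\<eta> \<in> borel_measurable (sources_algebra {Start})"
    by (rule measurable_eta) simp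
  note [measurable] = initial_measurable
  define F where "F x \<omega> = ennreal (discount a (hit_zero (\<lambda>t. x + \<mu> * t + W 0 t \<omega>)))" for x \<omega>
  have "(\<lambda>z. hit_zero (\<lambda>t. fst z + \<mu> * t + W 0 t (snd z))) \<in> borel_measurable (borel \<Otimes>\<^sub>M sources_algebra {Path 0})"
  proof (rule measurable_hit_zero)
    fix q :: real assume "0 \<le> q"
    then have [measurable]: "W 0 q \<in> borel_measurable (sources_algebra {Path 0})"
      by (intro measurable_W) auto
    show "(\<lambda>z. fst z + \<mu> * q + W 0 q (snd z)) \<in> borel_measurable (borel \<Otimes>\<^sub>M sources_algebra {Path 0})"
      by measurable
  qed
  then have F: "(\<lambda>(x, \<omega>). F x \<omega>) \<in> borel_measurable (borel \<Otimes>\<^sub>M sources_algebra {Path 0})"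
    unfolding F_def split_beta' by measurable
  have "(\<integral>\<^sup>+\<omega>. ennreal (discount a (cycle_hit \<mu> x\<^sub>R n \<omega>)) \<partial>M) = (\<integral>\<^sup>+\<omega>. F (\<eta> \<omega>) \<omega> \<partial>M)"
    by (simp add: F_def cycle_hit_def True)
  also have "\<dots> = (\<integral>\<^sup>+x. (\<integral>\<^sup>+\<omega>. F x \<omega> \<partial>M) \<partial>distr M borel \<eta>)"
    by (rule nn_integral_independent_sources[OF _ \<eta> F]) simp
  also have "\<dots> = (\<integral>\<^sup>+x. ennreal (exp (- \<theta> * x)) \<partial>distr M borel \<eta>)"
  proof (rule nn_integral_cong_AE)
    have "AE x in distr M borel \<eta>. 0 < x"
      using start(1) by (subst AE_distr_iff) auto
    then show "AE x in distr M borel \<eta>. (\<integral>\<^sup>+\<omega>. F x \<omega> \<partial>M) = ennreal (exp (- \<theta> * x))"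
      by eventually_elim (simp only: F_def laplace_hit_zero[OF brownian _ \<theta> a root])
  qed
  also have "\<dots> = (\<integral>\<^sup>+\<omega>. ennreal (exp (- \<theta> * \<eta> \<omega>)) \<partial>M)"
    by (subst nn_integral_distr) simp_all
  finally show ?thesis by (simp add: True)
qed

definition cycle_sources :: "nat \<Rightarrow> source set" where
  "cycle_sources n = insert (Wait n) (path_sources n)"

lemma nn_integral_prod_cycles:
  fixes V :: "nat \<Rightarrow> 'a \<Rightarrow> ennreal"
  assumes "\<And>i. V i \<in> borel_measurable (sources_algebra (cycle_sources i))" and "finite I"
  shows "(\<integral>\<^sup>+\<omega>. (\<Prod>i\<in>I. V i \<omega>) \<partial>M) = (\<Prod>i\<in>I. \<integral>\<^sup>+\<omega>. V i \<omega> \<partial>M)"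
proof (rule indep_vars_nn_integral)
  have "disjoint_family_on cycle_sources I"
    by (auto simp: disjoint_family_on_def cycle_sources_def path_sources_def)
  then show "indep_vars (\<lambda>_. borel) V I"
    by (intro indep_vars_of_subalgebras[OF indep_sources_algebras]) (auto intro: assms)
qed (use assms in auto)

lemma waiting_positive:
  assumes "0 < r"
  shows "AE \<omega> in M. 0 < T n \<omega>"
proof -
  have "prob {\<omega> \<in> space M. 0 < T n \<omega>} = 1"
    using exponential_distributedD_gt[OF waiting _ assms, of 0 n] by simp
  from AE_prob_1[OF this] show ?thesis
    by eventually_elim simp
qed

text \<open>
  The expected sum of \<open>exp (- S\<^sub>n)\<close> over all resetting times \<open>S\<^sub>n\<close> is a convergent geometric series.
  The sum is therefore almost surely finite, and its terms tend to zero.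
\<close>

lemma reset_times_diverge:
  assumes r: "0 < r"
  shows "AE \<omega> in M. filterlim (\<lambda>n. reset_time T n \<omega>) at_top sequentially"
proof -
  define V where "V i \<omega> = ennreal (exp (- T i \<omega>))" for i \<omega>
  have V: "V i \<in> borel_measurable (sources_algebra (cycle_sources i))" for i
    unfolding V_def
    by (rule measurable_compose[OF measurable_T[of i]]) (auto simp: cycle_sources_def)
  have VM[measurable]: "V i \<in> borel_measurable M" for i
    by (rule measurable_from_sources[OF V])
  define q where "q = r / (1 + r)"
  have q: "0 \<le> q" "q < 1"
    using r by (simp_all add: q_def)
  have "(\<integral>\<^sup>+\<omega>. V i \<omega> \<partial>M) = ennreal q" for i
    using nn_integral_reset_discount_waiting[OF r, of 1 \<infinity> i] by (simp add: V_def reset_discount_def q_def)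
  then have "(\<integral>\<^sup>+\<omega>. (\<Prod>i<n. V i \<omega>) \<partial>M) = ennreal (q ^ n)" for n
    using nn_integral_prod_cycles[OF V, of "{..<n}"] q by (simp add: ennreal_power)
  then have "(\<integral>\<^sup>+\<omega>. (\<Sum>n. \<Prod>i<n. V i \<omega>) \<partial>M) = (\<Sum>n. ennreal (q ^ n))"
    by (subst nn_integral_suminf) (simp_all only: borel_measurable_prod_ennreal VM)
  also have "\<dots> \<noteq> \<infinity>"
    unfolding infinity_ennreal_def
    by (rule ennreal_suminf_neq_top) (use q in \<open>simp_all add: summable_geometric\<close>)
  finally have "AE \<omega> in M. (\<Sum>n. \<Prod>i<n. V i \<omega>) \<noteq> \<infinity>"
    by (intro nn_integral_PInf_AE) measurable
  then show ?thesis
  proof eventually_elim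
    case (elim \<omega>)
    have "(\<Prod>i<n. V i \<omega>) = ennreal (exp (- reset_time T n \<omega>))" for n
      unfolding V_def reset_time_def
      by (subst prod_ennreal) (simp_all only: exp_ge_zero exp_sum[symmetric] sum_negf finite_lessThan)
    with elim have "(\<Sum>n. ennreal (exp (- reset_time T n \<omega>))) \<noteq> top"
      by (simp only: infinity_ennreal_def simp_thms)
    then have "summable (\<lambda>n. exp (- reset_time T n \<omega>))"
      by (rule summable_suminf_not_top[rotated]) simp
    then have lim: "(\<lambda>n. exp (- reset_time T n \<omega>)) \<longlonglongrightarrow> 0"
      by (rule summable_LIMSEQ_zero)
    show ?case
      unfolding filterlim_at_top
    proof
      fix Z
      show "\<forall>\<^sub>F n in sequentially. Z \<le> reset_time T n \<omega>"
        using order_tendstoD(2)[OF lim, of "exp (- Z)"] by (auto elim: eventually_mono)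
    qed
  qed
qed

text \<open>
  The series over cycles is geometric from its second term on: all cycles but the first start from the
  same point. With \<open>q = r / (l + r)\<close> and \<open>p = exp (- \<theta> x\<^sub>R)\<close> its sum is
  \<open>G + q (1 - G) p / (1 - q (1 - p))\<close>, and \<open>q p / (1 - q (1 - p))\<close> is the coefficient \<open>reset_coeff\<close>.
\<close>

lemma laplace_first_passage:
  fixes \<mu> x\<^sub>R l G :: real
  assumes r: "0 < r" and l: "0 < l" and start: "AE \<omega> in M. 0 < \<eta> \<omega>" "0 < x\<^sub>R"
  defines "\<theta> \<equiv> \<mu> + sqrt (\<mu>\<^sup>2 + 2 * (l + r))"
  assumes G: "(\<integral>\<^sup>+\<omega>. ennreal (exp (- \<theta> * \<eta> \<omega>)) \<partial>M) = ennreal G" "0 \<le> G" "G \<le> 1"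
  shows "(\<integral>\<^sup>+\<omega>. ennreal (discount l (first_passage_time (resetting_process \<mu> x\<^sub>R \<eta> W T) \<omega>)) \<partial>M) =
    ennreal ((1 - reset_coeff r l \<mu> x\<^sub>R) * G + reset_coeff r l \<mu> x\<^sub>R)"
proof -
  have root: "\<theta>\<^sup>2 / 2 - \<theta> * \<mu> = l + r" and \<theta>: "0 \<le> \<theta>"
    using laplace_exponent_root[of "l + r" \<mu>] laplace_exponent_nonneg[of "l + r" \<mu>] l r
    by (simp_all add: \<theta>_def)
  define p where "p = exp (- \<theta> * x\<^sub>R)"
  define q where "q = r / (l + r)"
  have p: "0 \<le> p" "p \<le> 1" and q: "0 \<le> q" "q < 1"
    using \<theta> start(2) r l by (simp_all add: p_def q_def)
  define \<sigma> where "\<sigma> n = cycle_hit \<mu> x\<^sub>R n" for n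
  define P where "P n = (if n = 0 then G else p)" for n :: nat
  have P: "0 \<le> P n" "P n \<le> 1" for n
    using G p by (simp_all add: P_def)
  have "(\<integral>\<^sup>+\<omega>. ennreal (discount (l + r) (\<sigma> n \<omega>)) \<partial>M) = ennreal (P n)" for n
    unfolding \<sigma>_def using laplace_cycle_hit[OF start \<theta> _ root, of n] r l G(1) by (simp add: P_def p_def)
  note cycle = expectation_cycle_discounts[OF r l P(1) this[unfolded \<sigma>_def], folded \<sigma>_def q_def]
  define A where "A i \<omega> = ennreal (reset_discount l (T i \<omega>) (\<sigma> i \<omega>))" for i \<omega>
  define B where "B i \<omega> = ennreal (hit_discount l (T i \<omega>) (\<sigma> i \<omega>))" for i \<omega>
  have pair: "(\<lambda>\<omega>. (\<sigma> i \<omega>, T i \<omega>)) \<in> measurable (sources_algebra (cycle_sources i)) (borel \<Otimes>\<^sub>M borel)" for i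
    unfolding \<sigma>_def by (intro measurable_Pair measurable_cycle_hit measurable_T) (auto simp: cycle_sources_def)
  have A: "A i \<in> borel_measurable (sources_algebra (cycle_sources i))" for i
    using measurable_compose[OF pair borel_measurable_reset_discount[of l]] unfolding A_def by simp
  have B: "B i \<in> borel_measurable (sources_algebra (cycle_sources i))" for i
    using measurable_compose[OF pair borel_measurable_hit_discount[of l]] unfolding B_def by simp
  note [measurable] = measurable_from_sources[OF A] measurable_from_sources[OF B]
  have summand: "(\<integral>\<^sup>+\<omega>. (\<Prod>i<n. A i \<omega>) * B n \<omega> \<partial>M) = ennreal ((\<Prod>i<n. q * (1 - P i)) * P n)" for n
  proof -
    define V where "V i = (if i < n then A i else B i)" for i
    have split: "{..n} = insert n {..<n}" by auto
    have "(\<integral>\<^sup>+\<omega>. (\<Prod>i<n. A i \<omega>) * B n \<omega> \<partial>M) = (\<integral>\<^sup>+\<omega>. (\<Prod>i\<le>n. V i \<omega>) \<partial>M)"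
      unfolding split by (simp add: V_def mult.commute)
    also have "\<dots> = (\<Prod>i\<le>n. \<integral>\<^sup>+\<omega>. V i \<omega> \<partial>M)"
      by (rule nn_integral_prod_cycles) (auto simp: V_def A B)
    also have "\<dots> = (\<Prod>i<n. ennreal (q * (1 - P i))) * ennreal (P n)"
      unfolding split by (simp add: V_def A_def[abs_def] B_def[abs_def] cycle mult.commute)
    also have "\<dots> = ennreal ((\<Prod>i<n. q * (1 - P i)) * P n)"
      by (subst prod_ennreal) (use P q in \<open>simp_all add: ennreal_mult''[symmetric]\<close>)
    finally show ?thesis .
  qed
  have "AE \<omega> in M. \<forall>n. 0 < T n \<omega> \<and> continuous_on {0..} (\<lambda>t. W n t \<omega>) \<and> W n 0 \<omega> = 0"
    using waiting_positive[OF r] brownian unfolding AE_all_countable standard_brownian_motion_def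
    by (auto intro: AE_conjI)
  with reset_times_diverge[OF r] start(1)
  have "AE \<omega> in M. ennreal (discount l (first_passage_time (resetting_process \<mu> x\<^sub>R \<eta> W T) \<omega>)) =
      (\<Sum>n. (\<Prod>i<n. A i \<omega>) * B n \<omega>)"
  proof eventually_elim
    case (elim \<omega>)
    then show ?case
      using discount_first_passage_time[of T \<omega> W \<eta> x\<^sub>R l \<mu>] start(2)
      by (simp add: A_def B_def \<sigma>_def cycle_hit_def)
  qed
  then have "(\<integral>\<^sup>+\<omega>. ennreal (discount l (first_passage_time (resetting_process \<mu> x\<^sub>R \<eta> W T) \<omega>)) \<partial>M) =
      (\<integral>\<^sup>+\<omega>. (\<Sum>n. (\<Prod>i<n. A i \<omega>) * B n \<omega>) \<partial>M)"
    by (rule nn_integral_cong_AE)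
  also have "\<dots> = (\<Sum>n. ennreal ((\<Prod>i<n. q * (1 - P i)) * P n))"
    by (subst nn_integral_suminf) (auto simp: summand)
  also have "\<dots> = ennreal ((1 - reset_coeff r l \<mu> x\<^sub>R) * G + reset_coeff r l \<mu> x\<^sub>R)"
  proof (rule suminf_ennreal_eq)
    show "0 \<le> (\<Prod>i<n. q * (1 - P i)) * P n" for n
      using P q by (intro mult_nonneg_nonneg prod_nonneg) auto
    have tail: "(\<Prod>i<Suc n. q * (1 - P i)) * P (Suc n) = (q * (1 - G) * p) * (q * (1 - p)) ^ n" for n
      unfolding prod.lessThan_Suc_shift by (simp add: P_def)
    have small: "q * (1 - p) < 1"
      using p q mult_left_le[of "1 - p" q] by simp
    then have "(\<lambda>n. (q * (1 - G) * p) * (q * (1 - p)) ^ n) sums ((q * (1 - G) * p) * (1 / (1 - q * (1 - p))))"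
      using p q by (intro sums_mult geometric_sums) auto
    then have "(\<lambda>n. (\<Prod>i<n. q * (1 - P i)) * P n) sums ((q * (1 - G) * p) * (1 / (1 - q * (1 - p))) + G)"
      unfolding tail[symmetric] by (subst (asm) sums_Suc_iff) (simp add: P_def)
    moreover have "(q * (1 - G) * p) * (1 / (1 - q * (1 - p))) + G =
        (1 - reset_coeff r l \<mu> x\<^sub>R) * G + reset_coeff r l \<mu> x\<^sub>R"
    proof -
      have C: "reset_coeff r l \<mu> x\<^sub>R = r * p / (l + r * p)"
      proof -
        have "- x\<^sub>R * \<theta> = - \<theta> * x\<^sub>R" by simp
        then show ?thesis
          by (simp only: reset_coeff_def p_def \<theta>_def[symmetric])
      qed
      have "0 < l + r * p" using l r p by (simp add: add_pos_nonneg)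
      have "1 - q * (1 - p) = (l + r * p) / (l + r)"
        using l r by (simp add: q_def field_simps)
      then have "q * p * (1 / (1 - q * (1 - p))) = r * p / (l + r * p)"
        using l r \<open>0 < l + r * p\<close> by (simp add: q_def)
      then have "(q * (1 - G) * p) * (1 / (1 - q * (1 - p))) = (1 - G) * (r * p / (l + r * p))"
        by (metis mult.assoc mult.commute)
      then have "(q * (1 - G) * p) * (1 / (1 - q * (1 - p))) = (1 - G) * reset_coeff r l \<mu> x\<^sub>R"
        unfolding C .
      then show ?thesis
        by (simp only:) (simp add: algebra_simps)
    qed
    ultimately show "(\<lambda>n. (\<Prod>i<n. q * (1 - P i)) * P n) sums
        ((1 - reset_coeff r l \<mu> x\<^sub>R) * G + reset_coeff r l \<mu> x\<^sub>R)" by simp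
  qed
  finally show ?thesis .
qed

end

section \<open>Laplace transforms of densities and of distribution functions\<close>

text \<open>
  A density is only prescribed on the positive half-line, hence the truncation \<open>h\<close>. The transform is at
  most 1 because the exponential factor is.
\<close>

lemma laplace_of_density:
  assumes f: "prob_density_pos f" and \<theta>: "0 \<le> \<theta>"
  defines "h \<equiv> \<lambda>x. indicator {0<..} x * f x"
  shows "h \<in> borel_measurable borel" "\<And>x. 0 \<le> h x" "integrable lborel h"
    "(\<integral>\<^sup>+x. ennreal (h x) * ennreal (exp (- \<theta> * x)) \<partial>lborel) = ennreal (laplace f \<theta>)"
    "0 \<le> laplace f \<theta>" "laplace f \<theta> \<le> 1"
proof -
  show h[measurable]: "h \<in> borel_measurable borel"
    using f by (simp add: prob_density_pos_def set_borel_measurable_def h_def)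
  show h0: "0 \<le> h x" for x
    using f by (simp add: prob_density_pos_def h_def indicator_def)
  have one: "(LINT x|lborel. h x) = 1"
    using f by (simp add: prob_density_pos_def set_lebesgue_integral_def h_def)
  then show int: "integrable lborel h"
    using not_integrable_integral_eq by fastforce
  have le: "exp (- \<theta> * x) * h x \<le> h x" for x
  proof (cases "0 < x")
    case True
    then have "exp (- \<theta> * x) * h x \<le> 1 * h x"
      using h0[of x] \<theta> by (intro mult_right_mono) auto
    then show ?thesis by simp
  qed (simp add: h_def)
  have int': "integrable lborel (\<lambda>x. exp (- \<theta> * x) * h x)"
    using le h0 by (intro Bochner_Integration.integrable_bound[OF int]) auto
  have eq: "laplace f \<theta> = (LINT x|lborel. exp (- \<theta> * x) * h x)"
    unfolding laplace_def set_lebesgue_integral_def h_def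
    by (intro Bochner_Integration.integral_cong) auto
  show "(\<integral>\<^sup>+x. ennreal (h x) * ennreal (exp (- \<theta> * x)) \<partial>lborel) = ennreal (laplace f \<theta>)"
    unfolding eq using h0 nn_integral_eq_integral[OF int']
    by (simp add: ennreal_mult''[symmetric] mult.commute)
  show "0 \<le> laplace f \<theta>"
    unfolding eq using h0 by (intro integral_nonneg_AE) auto
  show "laplace f \<theta> \<le> 1"
    unfolding eq one[symmetric] using le by (intro integral_mono int int')
qed

text \<open>
  Both sides are integrals of an exponential density against the distribution function, of \<open>\<tau>\<close> on the
  left and of the density \<open>f\<close> on the right. The two functions agree for \<open>s > 0\<close>, which is enough because
  the exponential density lives there up to a null set.
\<close>

lemma (in prob_space) laplace_eq_expectation_discount:
  assumes f: "prob_density_pos f" and l: "0 < l"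
    and \<tau>[measurable]: "\<tau> \<in> borel_measurable M" and nonneg: "\<And>\<omega>. 0 \<le> \<tau> \<omega>"
    and law: "\<And>t. 0 < t \<Longrightarrow> prob {\<omega> \<in> space M. \<tau> \<omega> \<le> ereal t} = (LINT s:{0<..t}|lborel. f s)"
  shows "(\<integral>\<^sup>+\<omega>. ennreal (discount l (\<tau> \<omega>)) \<partial>M) = ennreal (laplace f l)"
proof -
  define h where "h x = indicator {0<..} x * f x" for x
  have h[measurable]: "h \<in> borel_measurable borel" and h0: "\<And>x. 0 \<le> h x" and int: "integrable lborel h"
    and lap: "(\<integral>\<^sup>+x. ennreal (h x) * ennreal (exp (- l * x)) \<partial>lborel) = ennreal (laplace f l)"
    using laplace_of_density[OF f, of l] l unfolding h_def by simp_all
  interpret P: pair_sigma_finite M "lborel :: real measure"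
    by (intro pair_sigma_finite.intro sigma_finite_measure_axioms lborel.sigma_finite_measure_axioms)
  let ?e = "\<lambda>s. ennreal (exponential_density l s)"
  have cdf: "(\<integral>\<^sup>+\<omega>. indicator {s. \<tau> \<omega> \<le> ereal s} s \<partial>M) =
      (\<integral>\<^sup>+t. ennreal (h t) * indicator {s. ereal t \<le> ereal s} s \<partial>lborel)" if s: "0 < s" for s
  proof -
    have "(\<integral>\<^sup>+\<omega>. indicator {s. \<tau> \<omega> \<le> ereal s} s \<partial>M) = (\<integral>\<^sup>+\<omega>. indicator {\<omega> \<in> space M. \<tau> \<omega> \<le> ereal s} \<omega> \<partial>M)"
      by (intro nn_integral_cong) (auto simp: indicator_def)
    also have "\<dots> = ennreal (LINT t:{0<..s}|lborel. f t)"
      by (simp add: emeasure_eq_measure law[OF s])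
    also have "(LINT t:{0<..s}|lborel. f t) = (LINT t|lborel. indicator {..s} t * h t)"
      unfolding set_lebesgue_integral_def
      by (intro Bochner_Integration.integral_cong) (auto simp: h_def indicator_def)
    also have "ennreal \<dots> = (\<integral>\<^sup>+t. ennreal (indicator {..s} t * h t) \<partial>lborel)"
      using h0 integrable_mult_indicator[OF _ int, of "{..s}"]
      by (subst nn_integral_eq_integral) auto
    also have "\<dots> = (\<integral>\<^sup>+t. ennreal (h t) * indicator {s. ereal t \<le> ereal s} s \<partial>lborel)"
      by (intro nn_integral_cong) (auto simp: indicator_def)
    finally show ?thesis .
  qed
  have "(\<integral>\<^sup>+\<omega>. ennreal (discount l (\<tau> \<omega>)) \<partial>M) =
      (\<integral>\<^sup>+\<omega>. (\<integral>\<^sup>+s. ?e s * indicator {s. \<tau> \<omega> \<le> ereal s} s \<partial>lborel) \<partial>M)"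
    by (intro nn_integral_cong discount_eq_nn_integral l nonneg)
  also have "\<dots> = (\<integral>\<^sup>+s. (\<integral>\<^sup>+\<omega>. ?e s * indicator {s. \<tau> \<omega> \<le> ereal s} s \<partial>M) \<partial>lborel)"
    by (rule P.Fubini'[symmetric]) measurable
  also have "\<dots> = (\<integral>\<^sup>+s. ?e s * (\<integral>\<^sup>+\<omega>. indicator {s. \<tau> \<omega> \<le> ereal s} s \<partial>M) \<partial>lborel)"
    by (intro nn_integral_cong nn_integral_cmult) measurable
  also have "\<dots> = (\<integral>\<^sup>+s. ?e s * (\<integral>\<^sup>+t. ennreal (h t) * indicator {s. ereal t \<le> ereal s} s \<partial>lborel) \<partial>lborel)"
  proof (rule nn_integral_cong_AE)
    show "AE s in lborel. ?e s * (\<integral>\<^sup>+\<omega>. indicator {s. \<tau> \<omega> \<le> ereal s} s \<partial>M) =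
        ?e s * (\<integral>\<^sup>+t. ennreal (h t) * indicator {s. ereal t \<le> ereal s} s \<partial>lborel)"
      using AE_lborel_singleton[of 0]
    proof eventually_elim
      case (elim s)
      then consider "0 < s" | "s < 0" by linarith
      then show ?case
        by cases (simp_all add: cdf exponential_density_def)
    qed
  qed
  also have "\<dots> = (\<integral>\<^sup>+s. (\<integral>\<^sup>+t. ennreal (h t) * (?e s * indicator {s. ereal t \<le> ereal s} s) \<partial>lborel) \<partial>lborel)"
    by (subst nn_integral_cmult[symmetric]) (auto simp: ac_simps)
  also have "\<dots> = (\<integral>\<^sup>+t. (\<integral>\<^sup>+s. ennreal (h t) * (?e s * indicator {s. ereal t \<le> ereal s} s) \<partial>lborel) \<partial>lborel)"
    by (rule lborel_pair.Fubini') measurable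
  also have "\<dots> = (\<integral>\<^sup>+t. ennreal (h t) * (\<integral>\<^sup>+s. ?e s * indicator {s. ereal t \<le> ereal s} s \<partial>lborel) \<partial>lborel)"
    by (intro nn_integral_cong nn_integral_cmult) measurable
  also have "\<dots> = (\<integral>\<^sup>+t. ennreal (h t) * ennreal (exp (- l * t)) \<partial>lborel)"
  proof (rule nn_integral_cong)
    fix t :: real
    show "ennreal (h t) * (\<integral>\<^sup>+s. ?e s * indicator {s. ereal t \<le> ereal s} s \<partial>lborel) =
        ennreal (h t) * ennreal (exp (- l * t))"
      using discount_eq_nn_integral[OF l, of "ereal t"]
      by (cases "0 < t") (auto simp: h_def)
  qed
  finally show ?thesis
    using lap by simp
qed

theorem proposition3p1:
  fixes M :: "'a measure"
    and \<mu> r x\<^sub>R :: real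
    and \<eta> :: "'a \<Rightarrow> real"
    and W :: "nat \<Rightarrow> real \<Rightarrow> 'a \<Rightarrow> real"
    and T :: "nat \<Rightarrow> 'a \<Rightarrow> real"
    and f g :: "real \<Rightarrow> real"
  assumes "r > 0"
    and "x\<^sub>R > 0"
    and "resetting_noise M r \<eta> W T"
    and "prob_density_pos f"
    and "inverse_first_passage_solution M \<mu> x\<^sub>R \<eta> W T f g"
  shows "\<forall>l>0. laplace f l =
    (1 - reset_coeff r l \<mu> x\<^sub>R) * laplace g (\<mu> + sqrt (\<mu>\<^sup>2 + 2 * (l + r)))
      + reset_coeff r l \<mu> x\<^sub>R"
proof (intro allI impI)
  fix l :: real assume l: "0 < l"
  interpret resetting_noise M r \<eta> W T by fact
  define \<theta> where "\<theta> = \<mu> + sqrt (\<mu>\<^sup>2 + 2 * (l + r))"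
  define \<tau> where "\<tau> = first_passage_time (resetting_process \<mu> x\<^sub>R \<eta> W T)"
  have g: "prob_density_pos g"
    and \<eta>: "distributed M lborel \<eta> (\<lambda>x. ennreal (indicator {0<..} x * g x))"
    and \<tau>: "\<tau> \<in> borel_measurable M"
    and law: "\<And>t. 0 < t \<Longrightarrow> prob {\<omega> \<in> space M. \<tau> \<omega> \<le> ereal t} = (LINT s:{0<..t}|lborel. f s)"
    using assms(5) by (simp_all add: inverse_first_passage_solution_def \<tau>_def Let_def)
  have \<theta>: "0 \<le> \<theta>"
    using laplace_exponent_nonneg[of "l + r" \<mu>] l \<open>0 < r\<close> by (simp add: \<theta>_def)
  note density = laplace_of_density[OF g \<theta>]
  have start: "AE \<omega> in M. 0 < \<eta> \<omega>"
  proof -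
    have "AE x in density lborel (\<lambda>x. ennreal (indicator {0<..} x * g x)). 0 < x"
      using density(1) by (subst AE_density) (auto simp: indicator_def)
    then have "AE x in distr M lborel \<eta>. 0 < x"
      unfolding distributed_distr_eq_density[OF \<eta>] .
    then show ?thesis
      using distributed_measurable[OF \<eta>] by (subst (asm) AE_distr_iff) auto
  qed
  have G: "(\<integral>\<^sup>+\<omega>. ennreal (exp (- \<theta> * \<eta> \<omega>)) \<partial>M) = ennreal (laplace g \<theta>)"
    using distributed_nn_integral[OF \<eta>, of "\<lambda>x. ennreal (exp (- \<theta> * x))"] density(4) by simp
  have "0 \<le> \<tau> \<omega>" for \<omega>
    unfolding \<tau>_def first_passage_time_def by (rule Inf_greatest) auto
  from laplace_eq_expectation_discount[OF assms(4) l \<tau> this law]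
  have "ennreal (laplace f l) = ennreal ((1 - reset_coeff r l \<mu> x\<^sub>R) * laplace g \<theta> + reset_coeff r l \<mu> x\<^sub>R)"
    using laplace_first_passage[OF assms(1) l start assms(2) G[unfolded \<theta>_def] density(5,6)[unfolded \<theta>_def]]
    by (simp add: \<tau>_def \<theta>_def)
  moreover have "0 \<le> reset_coeff r l \<mu> x\<^sub>R" "reset_coeff r l \<mu> x\<^sub>R \<le> 1"
    using l assms(1) by (auto simp: reset_coeff_def divide_simps add_pos_pos)
  then have "0 \<le> (1 - reset_coeff r l \<mu> x\<^sub>R) * laplace g \<theta> + reset_coeff r l \<mu> x\<^sub>R"
    using density(5) by simp
  moreover have "0 \<le> laplace f l"
    using laplace_of_density(5)[OF assms(4), of l] l by simp
  ultimately show "laplace f l = (1 - reset_coeff r l \<mu> x\<^sub>R) * laplace g (\<mu> + sqrt (\<mu>\<^sup>2 + 2 * (l + r)))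
      + reset_coeff r l \<mu> x\<^sub>R"
    by (simp add: \<theta>_def)
qed

end
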